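(* Let $A\subset\mathbb{R}^d$ be an open bounded set, $\alpha\in[0,1]$, $\gamma\subset A$ a closed set with $\mathcal{H}^{d-1+\alpha}(\gamma)=0$, and let $F\in C^{0,\alpha}(A)$ be a vector field $F:A\to\mathbb{R}^d$ such that $$-\operatorname{div}(F)=g\quad\text{weakly on }A\setminus\gamma,$$ where $g\in C(\mathbb{R}^d)$ is a continuous function. Then $$-\operatorname{div}(F)=g\quad\text{weakly on }A .$$
   Context: $\mathcal{H}^s$ is the $s$-dimensional Hausdorff measure; $C^{0,0}$ means $C^0$. For an open set $U$, "$-\operatorname{div}(F)=g$ weakly on $U$" means $\int_U F\cdot\nabla\varphi\,dx=\int_U g\varphi\,dx$ for all $\varphi\in C^\infty_c(U)$. *)

theory Defs
  imports "HOL-Analysis.Analysis"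
begin

text \<open>
  Hausdorff measure. The weight of a covering set \<open>S\<close> is
  \<open>\<omega>\<^sub>s (diam S / 2)\<^sup>s\<close>, where \<open>\<omega>\<^sub>s\<close> is the volume of the \<open>s\<close>-dimensional unit ball.
  The case \<open>s = 0\<close> is separate because \<open>0 powr 0 = 0\<close>, whereas every nonempty set,
  including a singleton, must have weight 1 there. Boundedness of the covering sets is
  required explicitly because \<open>diameter\<close> carries no information about unbounded sets.
\<close>

definition hausdorff_weight :: "real \<Rightarrow> 'a::metric_space set \<Rightarrow> ennreal" where
  "hausdorff_weight s S =
     (if S = {} then 0
      else if s = 0 then 1
      else ennreal (unit_ball_vol s * (diameter S / 2) powr s))"

definition hausdorff_premeasure :: "real \<Rightarrow> real \<Rightarrow> 'a::metric_space set \<Rightarrow> ennreal" where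
  "hausdorff_premeasure s \<delta> E =
     (INF C \<in> {C :: nat \<Rightarrow> 'a set. E \<subseteq> (\<Union>i. C i) \<and> (\<forall>i. bounded (C i) \<and> diameter (C i) \<le> \<delta>)}.
        \<Sum>i. hausdorff_weight s (C i))"

definition hausdorff_measure :: "real \<Rightarrow> 'a::metric_space set \<Rightarrow> ennreal" where
  "hausdorff_measure s E = (SUP \<delta> \<in> {0<..}. hausdorff_premeasure s \<delta> E)"

definition holder_on ::
    "real \<Rightarrow> 'a::real_normed_vector set \<Rightarrow> ('a \<Rightarrow> 'b::real_normed_vector) \<Rightarrow> bool" where
  "holder_on \<alpha> A F \<longleftrightarrow>
     (if \<alpha> = 0 then continuous_on A F
      else \<exists>C. \<forall>x\<in>A. \<forall>y\<in>A. norm (F x - F y) \<le> C * norm (x - y) powr \<alpha>)"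

fun C_k :: "nat \<Rightarrow> ('a::euclidean_space \<Rightarrow> real) \<Rightarrow> bool" where
  "C_k 0 f \<longleftrightarrow> continuous_on UNIV f"
| "C_k (Suc k) f \<longleftrightarrow>
     (\<forall>x. f differentiable (at x)) \<and>
     (\<forall>b\<in>Basis. C_k k (\<lambda>x. frechet_derivative f (at x) b))"

definition gradient :: "('a::euclidean_space \<Rightarrow> real) \<Rightarrow> 'a \<Rightarrow> 'a" where
  "gradient f x = (\<Sum>b\<in>Basis. frechet_derivative f (at x) b *\<^sub>R b)"

text \<open>
  The space \<open>C\<^sub>c\<^sup>\<infinity>(U)\<close>: its elements are represented by their extensions by zero to
  the whole space.
\<close>

definition test_functions :: "'a::euclidean_space set \<Rightarrow> ('a \<Rightarrow> real) set" where
  "test_functions U =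
     {\<phi>. (\<forall>k. C_k k \<phi>) \<and> compact (closure {x. \<phi> x \<noteq> 0}) \<and> closure {x. \<phi> x \<noteq> 0} \<subseteq> U}"

definition weak_neg_div_eq ::
    "'a::euclidean_space set \<Rightarrow> ('a \<Rightarrow> 'a) \<Rightarrow> ('a \<Rightarrow> real) \<Rightarrow> bool" where
  "weak_neg_div_eq U F g \<longleftrightarrow>
     (\<forall>\<phi>\<in>test_functions U.
        (LINT x:U|lborel. F x \<bullet> gradient \<phi> x) = (LINT x:U|lborel. g x * \<phi> x))"

end

theory Submission
  imports Defs
begin

text \<open>
  Put \<open>s = d - 1 + \<alpha>\<close>. As \<open>\<gamma>\<close> is compact and \<open>\<H>\<^sup>s\<close>-null, it has a finite cover by balls with centres
  \<open>c\<^sub>i \<in> \<gamma>\<close> and dyadic radii \<open>r\<^sub>i\<close> such that \<open>\<Sum> r\<^sub>i\<^sup>s\<close> is small. There are smooth functions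
  \<open>\<theta>\<^sub>i\<close> supported in balls of radius \<open>3 r\<^sub>i\<close> with \<open>\<bar>\<nabla>\<theta>\<^sub>i\<bar> \<le> B / r\<^sub>i\<close> whose sum is 1 near \<open>\<gamma>\<close>. A test
  function \<open>\<phi>\<close> on \<open>A\<close> splits into \<open>\<phi> (1 - \<Sum> \<theta>\<^sub>i)\<close>, which is a test function on \<open>A - \<gamma>\<close>, and the pieces
  \<open>\<phi> \<theta>\<^sub>i\<close>. For a piece, \<open>\<integral> F \<bullet> \<nabla>(\<phi> \<theta>\<^sub>i) = \<integral> (F - F(c\<^sub>i)) \<bullet> \<nabla>(\<phi> \<theta>\<^sub>i)\<close> is of order
  \<open>r\<^sub>i\<^sup>\<alpha> r\<^sub>i\<^sup>-\<^sup>1 r\<^sub>i\<^sup>d = r\<^sub>i\<^sup>s\<close> and \<open>\<integral> g \<phi> \<theta>\<^sub>i\<close> is of order \<open>r\<^sub>i\<^sup>d \<le> r\<^sub>i\<^sup>s\<close>, so the pieces contribute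
  arbitrarily little.
\<close>

section \<open>Functions of class $C^k$ and gradients\<close>

lemma C_k_imp_continuous:
  assumes "C_k k f" shows "continuous_on UNIV f"
proof (cases k)
  case (Suc n)
  with \<open>C_k k f\<close> have "f differentiable_on UNIV"
    by (auto simp: differentiable_on_def)
  then show ?thesis by (rule differentiable_imp_continuous_on)
qed (use \<open>C_k k f\<close> in simp)

lemma C_k_SucD: "C_k (Suc k) f \<Longrightarrow> C_k k f"
proof (induction k arbitrary: f)
  case 0
  then show ?case using C_k_imp_continuous[OF 0] by simp
next
  case (Suc k)
  then show ?case using Suc.IH by (subst (asm) C_k.simps(2)) (subst C_k.simps(2), blast)
qed

lemma C_k_has_derivative:
  assumes "C_k (Suc k) f" shows "(f has_derivative frechet_derivative f (at x)) (at x)"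
  using assms frechet_derivative_works by auto

text \<open>\<open>C_k\<close> refers to the derivative picked by \<open>frechet_derivative\<close>.
  Derivatives are unique, so any explicit candidate \<open>f'\<close> may be used in its
  place.\<close>

lemma C_k_SucI:
  assumes "\<And>x. (f has_derivative f' x) (at x)" and "\<And>b. b \<in> Basis \<Longrightarrow> C_k k (\<lambda>x. f' x b)"
  shows "C_k (Suc k) f"
proof -
  have "frechet_derivative f (at x) = f' x" for x
    using frechet_derivative_at[OF assms(1)] by simp
  then show ?thesis using assms by (auto simp: differentiable_def)
qed

lemma C_k_const: "C_k k (\<lambda>x. c)"
proof (induction k arbitrary: c)
  case (Suc k)
  show ?case by (rule C_k_SucI[where f' = "\<lambda>_ _. 0"]) (simp_all add: Suc.IH)
qed simp

lemma C_k_add: "C_k k f \<Longrightarrow> C_k k g \<Longrightarrow> C_k k (\<lambda>x. f x + g x)"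
proof (induction k arbitrary: f g)
  case 0
  then show ?case by (auto intro: continuous_intros)
next
  case (Suc k)
  show ?case
  proof (rule C_k_SucI)
    show "((\<lambda>x. f x + g x) has_derivative
      (\<lambda>h. frechet_derivative f (at x) h + frechet_derivative g (at x) h)) (at x)" for x
      using has_derivative_add[OF C_k_has_derivative C_k_has_derivative, OF Suc.prems] .
    show "C_k k (\<lambda>x. frechet_derivative f (at x) b + frechet_derivative g (at x) b)" if "b \<in> Basis" for b
      using Suc.IH Suc.prems that by simp
  qed
qed

lemma C_k_mult: "C_k k f \<Longrightarrow> C_k k g \<Longrightarrow> C_k k (\<lambda>x. f x * g x)"
proof (induction k arbitrary: f g)
  case 0
  then show ?case by (auto intro: continuous_intros)
next
  case (Suc k)
  show ?case
  proof (rule C_k_SucI)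
    show "((\<lambda>x. f x * g x) has_derivative
      (\<lambda>h. f x * frechet_derivative g (at x) h + frechet_derivative f (at x) h * g x)) (at x)" for x
      using has_derivative_mult[OF C_k_has_derivative C_k_has_derivative, OF Suc.prems] .
    show "C_k k (\<lambda>x. f x * frechet_derivative g (at x) b + frechet_derivative f (at x) b * g x)"
      if "b \<in> Basis" for b
      using Suc.prems that by (intro C_k_add Suc.IH C_k_SucD[OF Suc.prems(1)] C_k_SucD[OF Suc.prems(2)]) simp_all
  qed
qed

lemma C_k_diff: "C_k k f \<Longrightarrow> C_k k g \<Longrightarrow> C_k k (\<lambda>x. f x - g x)"
  using C_k_add[OF _ C_k_mult[OF C_k_const[of k "-1"]], of f g] by simp

lemma C_k_sum: "(\<And>i. i \<in> I \<Longrightarrow> C_k k (f i)) \<Longrightarrow> C_k k (\<lambda>x. \<Sum>i\<in>I. f i x)"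
  by (induction I rule: infinite_finite_induct) (auto intro: C_k_const C_k_add)

lemma C_k_prod: "(\<And>i. i \<in> I \<Longrightarrow> C_k k (f i)) \<Longrightarrow> C_k k (\<lambda>x. \<Prod>i\<in>I. f i x)"
  by (induction I rule: infinite_finite_induct) (auto intro: C_k_const C_k_mult)

lemma C_k_inverse:
  "C_k k f \<Longrightarrow> (\<And>x. f x \<noteq> 0) \<Longrightarrow> C_k k (\<lambda>x. inverse (f x))"
proof (induction k)
  case 0
  then show ?case by (auto intro: continuous_intros)
next
  case (Suc k)
  have inv: "C_k k (\<lambda>x. inverse (f x))"
    using Suc C_k_SucD by blast
  show ?case
  proof (rule C_k_SucI)
    show "((\<lambda>x. inverse (f x)) has_derivative
       (\<lambda>h. -1 * (inverse (f x) * frechet_derivative f (at x) h * inverse (f x)))) (at x)" for x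
      using Deriv.has_derivative_inverse[OF Suc.prems(2) C_k_has_derivative[OF Suc.prems(1)]] by simp
    show "C_k k (\<lambda>x. -1 * (inverse (f x) * frechet_derivative f (at x) b * inverse (f x)))"
      if "b \<in> Basis" for b
      using Suc.prems that by (intro C_k_mult inv C_k_const) simp
  qed
qed

text \<open>The chain rule produces a factor \<open>h' (f x)\<close>, with \<open>h'\<close> again
  of every class, so the induction is on \<open>k\<close> with \<open>h\<close> arbitrary. A linear
  map on the reals is multiplication by its value at 1, hence the form of
  \<open>?h'\<close>.\<close>

lemma C_k_compose:
  fixes h :: "real \<Rightarrow> real"
  shows "(\<And>n. C_k n h) \<Longrightarrow> C_k k f \<Longrightarrow> C_k k (\<lambda>x. h (f x))"
proof (induction k arbitrary: h)
  case 0
  have "continuous_on UNIV h" using 0(1)[of 0] by simp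
  then show ?case using 0(2) by (auto intro: continuous_on_compose2)
next
  case (Suc k)
  let ?h' = "\<lambda>t. frechet_derivative h (at t) 1"
  have h': "C_k n ?h'" for n using Suc.prems(1)[of "Suc n"] by simp
  have dh: "(h has_derivative (\<lambda>s. s * ?h' t)) (at t)" for t
  proof -
    have "(h has_derivative frechet_derivative h (at t)) (at t)"
      using C_k_has_derivative[OF Suc.prems(1)] .
    moreover from this obtain c where "frechet_derivative h (at t) = (\<lambda>s. s * c)"
      using has_derivative_bounded_linear real_bounded_linear by blast
    ultimately show ?thesis by simp
  qed
  show ?case
  proof (rule C_k_SucI)
    show "((\<lambda>x. h (f x)) has_derivative (\<lambda>v. frechet_derivative f (at x) v * ?h' (f x))) (at x)" for x
      using has_derivative_compose[OF C_k_has_derivative[OF Suc.prems(2)] dh] .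
    show "C_k k (\<lambda>x. frechet_derivative f (at x) b * ?h' (f x))" if "b \<in> Basis" for b
      using Suc.prems(2) that Suc.IH[OF h' C_k_SucD[OF Suc.prems(2)]] by (auto intro!: C_k_mult)
  qed
qed

lemma C_k_inner_affine: "C_k k (\<lambda>x. (x - c) \<bullet> v)"
proof (cases k)
  case (Suc n)
  have "C_k (Suc n) (\<lambda>x. (x - c) \<bullet> v)"
    by (rule C_k_SucI[where f' = "\<lambda>_ h. h \<bullet> v"]) (auto intro!: derivative_eq_intros C_k_const)
  then show ?thesis using Suc by simp
qed (auto intro!: continuous_intros)

lemma C_k_norm_sq: "C_k k (\<lambda>x. (x - c) \<bullet> (x - c))"
proof (cases k)
  case (Suc n)
  have "C_k (Suc n) (\<lambda>x. (x - c) \<bullet> (x - c))"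
  proof (rule C_k_SucI)
    show "((\<lambda>x. (x - c) \<bullet> (x - c)) has_derivative (\<lambda>h. 2 * ((x - c) \<bullet> h))) (at x)" for x
      by (auto intro!: derivative_eq_intros simp: inner_commute)
  qed (intro C_k_mult C_k_const C_k_inner_affine)
  then show ?thesis using Suc by simp
qed (auto intro!: continuous_intros)

section \<open>Calculus rules for the gradient\<close>

lemma gradient_eqI:
  assumes "GDERIV f x :> G" shows "gradient f x = G"
  using frechet_derivative_at[OF assms[unfolded gderiv_def], symmetric]
  by (simp add: gradient_def euclidean_representation inner_commute[of _ G])

lemma C_k_GDERIV:
  assumes "C_k (Suc k) f" shows "GDERIV f x :> gradient f x"
proof -
  have "frechet_derivative f (at x) h = h \<bullet> gradient f x" for h
  proof -
    have lin: "linear (frechet_derivative f (at x))"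
      using C_k_has_derivative[OF assms] has_derivative_linear by blast
    have "frechet_derivative f (at x) h = frechet_derivative f (at x) (\<Sum>b\<in>Basis. (h \<bullet> b) *\<^sub>R b)"
      by (simp add: euclidean_representation)
    also have "\<dots> = h \<bullet> gradient f x"
      by (simp add: linear_sum[OF lin] linear_scale[OF lin] gradient_def inner_sum_right mult.commute)
    finally show ?thesis .
  qed
  then show ?thesis
    unfolding gderiv_def by (rule has_derivative_eq_rhs[OF C_k_has_derivative[OF assms] ext])
qed

lemma C_k_gradient_continuous:
  assumes "C_k (Suc k) f" shows "continuous_on UNIV (gradient f)"
  unfolding gradient_def using assms
  by (intro continuous_on_sum continuous_on_scaleR continuous_on_const C_k_imp_continuous[of k]) simp

lemma gradient_mult:
  assumes "C_k (Suc k) f" "C_k (Suc l) g"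
  shows "gradient (\<lambda>x. f x * g x) x = f x *\<^sub>R gradient g x + g x *\<^sub>R gradient f x"
  by (rule gradient_eqI) (rule GDERIV_mult[OF C_k_GDERIV C_k_GDERIV, OF assms])

lemma gradient_diff:
  assumes "C_k (Suc k) f" "C_k (Suc l) g"
  shows "gradient (\<lambda>x. f x - g x) x = gradient f x - gradient g x"
  by (rule gradient_eqI) (rule GDERIV_diff[OF C_k_GDERIV C_k_GDERIV, OF assms])

lemma gradient_const: "gradient (\<lambda>x. c) x = 0"
  by (rule gradient_eqI) (rule GDERIV_const)

lemma gradient_add:
  assumes "C_k (Suc k) f" "C_k (Suc l) g"
  shows "gradient (\<lambda>x. f x + g x) x = gradient f x + gradient g x"
  by (rule gradient_eqI) (rule GDERIV_add[OF C_k_GDERIV C_k_GDERIV, OF assms])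

lemma gradient_zero:
  assumes "open S" "x \<in> S" "\<And>y. y \<in> S \<Longrightarrow> f y = 0"
  shows "gradient f x = 0"
proof (rule gradient_eqI)
  have "((\<lambda>x. 0) has_derivative (\<lambda>_. 0)) (at x)" by simp
  then show "GDERIV f x :> 0"
    unfolding gderiv_def
    by (auto intro: has_derivative_transform_within_open[where f="\<lambda>x. 0", OF _ assms(1,2)] simp: assms(3))
qed

section \<open>Smooth cutoff functions\<close>

text \<open>The classical flat function \<open>exp (- 1 / t)\<close>, extended by 0 to
  \<open>t \<le> 0\<close>. The polynomial factor in \<open>1 / t\<close> makes the family closed
  under differentiation, so that smoothness follows by one induction.\<close>

definition exp_inv_poly :: "real poly \<Rightarrow> real \<Rightarrow> real" where
  "exp_inv_poly p t = (if t \<le> 0 then 0 else poly p (inverse t) * exp (- inverse t))"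

text \<open>With \<open>y = 1 / t\<close> the limit from the right becomes the decay of a polynomial
  times \<open>exp (- y)\<close> at infinity; on the left the function is 0.\<close>

lemma exp_inv_poly_tendsto_0: "((exp_inv_poly p) \<longlongrightarrow> 0) (at 0)"
proof -
  have mono: "((\<lambda>y::real. poly p y * exp (- y)) \<longlongrightarrow> 0) at_top" for p :: "real poly"
  proof -
    have "((\<lambda>y::real. \<Sum>i\<le>degree p. coeff p i * (y ^ i / exp y)) \<longlongrightarrow> (\<Sum>i\<le>degree p. coeff p i * 0)) at_top"
      by (intro tendsto_intros tendsto_power_div_exp_0)
    then show ?thesis
      by (simp add: poly_altdef sum_distrib_right exp_minus divide_inverse mult.assoc)
  qed
  have "((\<lambda>t. poly p (inverse t) * exp (- inverse t)) \<longlongrightarrow> 0) (at_right 0)"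
    using filterlim_compose[OF mono filterlim_inverse_at_top_right] .
  then have right: "((exp_inv_poly p) \<longlongrightarrow> 0) (at_right 0)"
    by (rule Lim_transform_eventually)
      (auto simp: exp_inv_poly_def eventually_at_filter)
  have left: "((exp_inv_poly p) \<longlongrightarrow> 0) (at_left 0)"
    by (rule Lim_transform_eventually[OF tendsto_const])
      (auto simp: exp_inv_poly_def eventually_at_filter)
  show ?thesis using left right filterlim_split_at by blast
qed

text \<open>For \<open>t > 0\<close> both the inner derivative of \<open>p\<close> and that of the
  exponential bring out \<open>1 / t ^ 2\<close>, with opposite signs; this is the factor
  \<open>[:0, 0, 1:]\<close> and the difference \<open>p - pderiv p\<close>.\<close>

lemma exp_inv_poly_deriv:
  "((exp_inv_poly p) has_real_derivative exp_inv_poly ([:0, 0, 1:] * (p - pderiv p)) t) (at t)"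
proof (cases "t = 0")
  case True
  \<comment> \<open>The difference quotient at 0 is itself in the family, with polynomial
    \<open>[:0, 1:] * p\<close>, so it tends to 0.\<close>
  have "((\<lambda>h. (exp_inv_poly p (0 + h) - exp_inv_poly p 0) / h) \<longlongrightarrow> 0) (at 0)"
    by (rule Lim_transform_eventually[OF exp_inv_poly_tendsto_0[of "[:0, 1:] * p"]])
      (auto simp: exp_inv_poly_def field_simps)
  then show ?thesis using True by (simp add: DERIV_def exp_inv_poly_def)
next
  case False
  then consider "t < 0" | "t > 0" by linarith
  then show ?thesis
  proof cases
    case 1
    have "((\<lambda>_. 0) has_real_derivative 0) (at t)" by simp
    then have "((exp_inv_poly p) has_real_derivative 0) (at t)"
      by (rule has_field_derivative_transform_within_open[of _ _ _ "{..<0}"])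
        (use 1 in \<open>auto simp: exp_inv_poly_def\<close>)
    then show ?thesis using 1 by (simp add: exp_inv_poly_def)
  next
    case 2
    have "((\<lambda>t. poly p (inverse t) * exp (- inverse t)) has_real_derivative
        (poly (pderiv p) (inverse t) * (- (inverse t)\<^sup>2)) * exp (- inverse t)
        + poly p (inverse t) * (exp (- inverse t) * (inverse t)\<^sup>2)) (at t)"
      using 2 by (auto intro!: derivative_eq_intros DERIV_chain2[OF poly_DERIV] simp: power2_eq_square)
    then have "((exp_inv_poly p) has_real_derivative
        (poly (pderiv p) (inverse t) * (- (inverse t)\<^sup>2)) * exp (- inverse t)
        + poly p (inverse t) * (exp (- inverse t) * (inverse t)\<^sup>2)) (at t)"
      by (rule has_field_derivative_transform_within_open[of _ _ _ "{0<..}"])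
        (use 2 in \<open>auto simp: exp_inv_poly_def\<close>)
    then show ?thesis using 2
      by (simp add: exp_inv_poly_def algebra_simps power2_eq_square)
  qed
qed

lemma C_k_exp_inv_poly: "C_k k (exp_inv_poly p)"
proof (induction k arbitrary: p)
  case 0
  show ?case using exp_inv_poly_deriv[of p] by (auto intro!: DERIV_continuous_on)
next
  case (Suc k)
  show ?case
  proof (rule C_k_SucI)
    show "(exp_inv_poly p has_derivative
       (\<lambda>h. exp_inv_poly ([:0, 0, 1:] * (p - pderiv p)) t * h)) (at t)" for t
      using exp_inv_poly_deriv by (simp add: has_field_derivative_def)
  qed (use Suc in simp)
qed

lemma C_k_has_real_derivative:
  fixes h :: "real \<Rightarrow> real"
  assumes "C_k (Suc k) h"
  shows "(h has_real_derivative gradient h t) (at t)"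
  using C_k_GDERIV[OF assms] by simp

text \<open>With \<open>e\<close> the flat function, take
  \<open>e (b - t) / (e (b - t) + e (t - a))\<close>. As \<open>a < b\<close>, the arguments
  \<open>b - t\<close> and \<open>t - a\<close> are never both nonpositive, so the denominator is
  positive. Outside \<open>{a..b}\<close> the quotient is locally constant, hence its derivative is
  bounded by compactness of \<open>{a..b}\<close>.\<close>

lemma smooth_cutoff_real:
  fixes a b :: real
  assumes "a < b"
  obtains h :: "real \<Rightarrow> real" and M where
    "\<And>k. C_k k h" "\<And>t. 0 \<le> h t" "\<And>t. h t \<le> 1"
    "\<And>t. t \<le> a \<Longrightarrow> h t = 1" "\<And>t. b \<le> t \<Longrightarrow> h t = 0" "\<And>t. \<bar>gradient h t\<bar> \<le> M"
proof -
  let ?e = "exp_inv_poly 1"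
  let ?h = "\<lambda>t. ?e (b - t) * inverse (?e (b - t) + ?e (t - a))"
  have e: "?e t \<ge> 0" "?e t > 0 \<longleftrightarrow> t > 0" "?e t = 0 \<longleftrightarrow> t \<le> 0" for t
    by (auto simp: exp_inv_poly_def)
  have pos: "?e (b - t) + ?e (t - a) > 0" for t
    using e(1)[of "b - t"] e(1)[of "t - a"] e(2)[of "b - t"] e(2)[of "t - a"] assms
    by (cases "t < b") (auto simp: add_pos_nonneg add_nonneg_pos)
  have e1: "C_k k (\<lambda>t. ?e (b - t))" "C_k k (\<lambda>t. ?e (t - a))" for k
  proof -
    have "C_k k (\<lambda>t. b - t)" "C_k k (\<lambda>t. t - a)"
      using C_k_inner_affine[of k b "-1::real"] C_k_inner_affine[of k a "1::real"] by simp_all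
    then show "C_k k (\<lambda>t. ?e (b - t))" "C_k k (\<lambda>t. ?e (t - a))"
      using C_k_compose[OF C_k_exp_inv_poly] by blast+
  qed
  have sm: "C_k k ?h" for k
    by (intro C_k_mult C_k_inverse C_k_add e1) (use pos in \<open>simp add: less_imp_neq[THEN not_sym]\<close>)
  have out: "gradient ?h t = 0" if "t \<notin> {a..b}" for t
  proof (cases "t > b")
    case True
    then show ?thesis
      by (intro gradient_zero[where S="{b<..}"]) (auto simp: exp_inv_poly_def)
  next
    case False
    then have "t < a" using that by auto
    have "((\<lambda>_. 1) has_real_derivative 0) (at t)" by simp
    then have "(?h has_real_derivative 0) (at t)"
      by (rule has_field_derivative_transform_within_open[of _ _ _ "{..<a}"])
        (use assms \<open>t < a\<close> in \<open>auto simp: exp_inv_poly_def\<close>)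
    then show ?thesis by (intro gradient_eqI) simp
  qed
  have "compact (gradient ?h ` {a..b})"
    by (intro compact_continuous_image continuous_on_subset[OF C_k_gradient_continuous[OF sm[of "Suc 0"]]]) auto
  then have "bounded (gradient ?h ` {a..b})" by (rule compact_imp_bounded)
  then obtain M where M: "\<And>t. t \<in> {a..b} \<Longrightarrow> \<bar>gradient ?h t\<bar> \<le> M"
    unfolding bounded_iff real_norm_def by blast
  show thesis
  proof (rule that[of ?h M])
    show "?h t \<ge> 0" for t using e(1) pos[of t] by simp
    show "?h t \<le> 1" for t
      using e(1)[of "t - a"] pos[of t] by (simp add: divide_inverse[symmetric])
    show "?h t = 1" if "t \<le> a" for t
      using that assms e(3)[of "t - a"] e(3)[of "b - t"] by auto
    show "?h t = 0" if "b \<le> t" for t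
      using that e(3)[of "b - t"] by auto
    show "\<bar>gradient ?h t\<bar> \<le> M" for t
      using M[of t] M[of a] out[of t] assms by (cases "t \<in> {a..b}") auto
  qed (rule sm)
qed

lemma GDERIV_norm_sq: "GDERIV (\<lambda>x. (x - c) \<bullet> (x - c)) x :> 2 *\<^sub>R (x - c)"
  unfolding gderiv_def by (auto intro!: derivative_eq_intros simp: inner_commute)

text \<open>A single cutoff is applied to the squared distance divided by \<open>r ^ 2\<close>,
  which, unlike the distance, is smooth at the centre. The thresholds 4 and 9 are the squares of 2
  and 3. As the argument has gradient \<open>2 (x - c) / r ^ 2\<close>, of norm at most
  \<open>6 / r\<close> on the ball of radius \<open>3 r\<close>, the constant is
  \<open>6 * M\<close>.\<close>

lemma scaled_bumps:
  obtains \<psi> :: "'a::euclidean_space \<Rightarrow> real \<Rightarrow> 'a \<Rightarrow> real" and B where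
    "B \<ge> 0" "\<And>c r k. r > 0 \<Longrightarrow> C_k k (\<psi> c r)" "\<And>c r x. 0 \<le> \<psi> c r x" "\<And>c r x. \<psi> c r x \<le> 1"
    "\<And>c r x. r > 0 \<Longrightarrow> dist c x \<le> 2 * r \<Longrightarrow> \<psi> c r x = 1"
    "\<And>c r x. r > 0 \<Longrightarrow> 3 * r \<le> dist c x \<Longrightarrow> \<psi> c r x = 0"
    "\<And>c r x. r > 0 \<Longrightarrow> norm (gradient (\<psi> c r) x) \<le> B / r"
    "\<And>c r x. r > 0 \<Longrightarrow> 3 * r < dist c x \<Longrightarrow> gradient (\<psi> c r) x = 0"
proof -
  obtain h :: "real \<Rightarrow> real" and M where
    h: "\<And>k. C_k k h" "\<And>t. 0 \<le> h t" "\<And>t. h t \<le> 1"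
      "\<And>t. t \<le> 4 \<Longrightarrow> h t = 1" "\<And>t. 9 \<le> t \<Longrightarrow> h t = 0" "\<And>t. \<bar>gradient h t\<bar> \<le> M"
    using smooth_cutoff_real[of 4 9] by auto
  have M: "M \<ge> 0" using h(6)[of 0] by simp
  define q where "q c r x = inverse (r\<^sup>2) * ((x - c) \<bullet> (x - c))" for c x :: 'a and r :: real
  have q: "q c r x = (dist c x / r)\<^sup>2" for c x :: 'a and r :: real
  proof -
    have "(dist c x)\<^sup>2 = (x - c) \<bullet> (x - c)"
      by (simp add: dist_norm norm_minus_commute[of c] power2_norm_eq_inner)
    then show ?thesis by (simp add: q_def power_divide) (simp add: divide_inverse mult.commute)
  qed
  have q4: "q c r x \<le> 4 \<longleftrightarrow> dist c x \<le> 2 * r" and q9: "9 \<le> q c r x \<longleftrightarrow> 3 * r \<le> dist c x"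
    if "r > 0" for c x :: 'a and r
    using that power2_le_iff_abs_le[of 2 "dist c x / r"] abs_le_square_iff[of 3 "dist c x / r"]
    by (auto simp: q field_simps)
  have zero: "gradient (\<lambda>x. h (q c r x)) x = 0" if "r > 0" "3 * r < dist c x" for c x :: 'a and r
  proof (rule gradient_zero)
    show "open (- cball c (3 * r))" by (simp add: open_Compl)
    show "h (q c r y) = 0" if "y \<in> - cball c (3 * r)" for y
      using that q9[OF \<open>r > 0\<close>] by (intro h(5)) simp
  qed (use that in simp)
  show thesis
  proof (rule that[of "6 * M" "\<lambda>c r x. h (q c r x)"])
    show "C_k k (\<lambda>x. h (q c r x))" for k c r
      unfolding q_def
      by (rule C_k_compose[OF h(1)], rule C_k_mult[OF C_k_const C_k_norm_sq])
    show "norm (gradient (\<lambda>x. h (q c r x)) x) \<le> 6 * M / r" if r: "r > 0" for c r x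
    proof (cases "dist c x \<le> 3 * r")
      case True
      have "GDERIV (\<lambda>x. inverse (r\<^sup>2) * ((x - c) \<bullet> (x - c))) x :>
          inverse (r\<^sup>2) *\<^sub>R (2 *\<^sub>R (x - c)) + ((x - c) \<bullet> (x - c)) *\<^sub>R 0"
        by (rule GDERIV_mult[OF GDERIV_const GDERIV_norm_sq])
      then have "GDERIV (q c r) x :> inverse (r\<^sup>2) *\<^sub>R (2 *\<^sub>R (x - c))"
        unfolding q_def[abs_def] by simp
      then have "gradient (\<lambda>x. h (q c r x)) x =
          gradient h (q c r x) *\<^sub>R inverse (r\<^sup>2) *\<^sub>R (2 *\<^sub>R (x - c))"
        using GDERIV_DERIV_compose C_k_has_real_derivative[OF h(1)] by (intro gradient_eqI) blast
      then have "norm (gradient (\<lambda>x. h (q c r x)) x) = \<bar>gradient h (q c r x)\<bar> * (2 * dist c x / r\<^sup>2)"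
        by (simp add: dist_norm norm_minus_commute divide_inverse abs_mult)
      also have "\<dots> \<le> M * (2 * (3 * r) / r\<^sup>2)"
        using True r M h(6) by (intro mult_mono divide_right_mono) auto
      also have "\<dots> = 6 * M / r" using r by (simp add: power2_eq_square)
      finally show ?thesis .
    next
      case False
      then show ?thesis using zero[OF r] M r by simp
    qed
  qed (use M h q4 q9 zero in auto)
qed

section \<open>Partitions of unity of graded scale\<close>

text \<open>Greedy choice: a new point is kept exactly when no point kept so far is closer than
  \<open>r\<close>.\<close>

lemma separated_subset:
  fixes S :: "'a::metric_space set"
  assumes "finite S" "r > 0"
  shows "\<exists>T\<subseteq>S. (\<forall>x\<in>T. \<forall>y\<in>T. x \<noteq> y \<longrightarrow> r \<le> dist x y) \<and> (\<forall>s\<in>S. \<exists>t\<in>T. dist t s < r)"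
  using assms(1)
proof (induction S)
  case (insert x S)
  then obtain T where T: "T \<subseteq> S" "\<forall>x\<in>T. \<forall>y\<in>T. x \<noteq> y \<longrightarrow> r \<le> dist x y" "\<forall>s\<in>S. \<exists>t\<in>T. dist t s < r"
    by blast
  show ?case
  proof (cases "\<exists>t\<in>T. dist t x < r")
    case True
    then show ?thesis using T by (intro exI[of _ T]) auto
  next
    case False
    then show ?thesis using T assms(2)
      by (intro exI[of _ "insert x T"]) (auto simp: dist_commute not_less)
  qed
qed auto

text \<open>Volume comparison: the balls of radius \<open>r / 2\<close> about the points are
  disjoint and lie in the ball of radius \<open>3 r + r / 2\<close>, which is 7 times as large in
  radius.\<close>

lemma card_separated_le:
  fixes T :: "'a::euclidean_space set"
  assumes "finite T" "r > 0" and sep: "\<And>x y. x \<in> T \<Longrightarrow> y \<in> T \<Longrightarrow> x \<noteq> y \<Longrightarrow> r \<le> dist x y"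
    and T: "T \<subseteq> cball z (3 * r)"
  shows "real (card T) \<le> 7 ^ DIM('a)"
proof -
  let ?v = "unit_ball_vol (real DIM('a))"
  have disj: "disjoint_family_on (\<lambda>t. ball t (r / 2)) T"
    unfolding disjoint_family_on_def
  proof (intro ballI impI)
    fix x y assume "x \<in> T" "y \<in> T" "x \<noteq> y"
    then have "r \<le> dist x y" by (rule sep)
    then show "ball x (r / 2) \<inter> ball y (r / 2) = {}"
      by (auto simp: disjoint_iff) (smt (verit) dist_commute dist_triangle field_sum_of_halves)
  qed
  have "real (card T) * (?v * (r / 2) ^ DIM('a)) = (\<Sum>t\<in>T. measure lborel (ball t (r / 2)))"
    using assms(2) by (simp add: content_ball)
  also have "\<dots> = measure lborel (\<Union>t\<in>T. ball t (r / 2))"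
  proof (rule measure_finite_Union[symmetric])
    show "emeasure lborel (ball t (r / 2)) \<noteq> \<infinity>" for t :: 'a
      using emeasure_lborel_ball_finite[of t "r / 2"] by simp
  qed (use assms disj in auto)
  also have "\<dots> \<le> measure lborel (cball z (7 * r / 2))"
  proof (rule measure_mono_fmeasurable)
    show "(\<Union>t\<in>T. ball t (r / 2)) \<subseteq> cball z (7 * r / 2)"
    proof
      fix x assume "x \<in> (\<Union>t\<in>T. ball t (r / 2))"
      then obtain t where "t \<in> T" "dist t x < r / 2" by auto
      then show "x \<in> cball z (7 * r / 2)"
        using T dist_triangle[of z x t] by auto
    qed
  qed (auto intro: fmeasurableI emeasure_lborel_cball_finite simp: assms(1))
  also have "\<dots> = ?v * (7 * (r / 2)) ^ DIM('a)"
    using assms(2) by (simp add: content_cball)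
  finally have "real (card T) * (?v * (r / 2) ^ DIM('a)) \<le> 7 ^ DIM('a) * (?v * (r / 2) ^ DIM('a))"
    by (simp only: power_mult_distrib mult_ac)
  then show ?thesis using assms(2) by (simp add: mult_le_cancel_right)
qed

text \<open>The summands are the functions \<open>\<theta> i\<close> of the partition below. Their
  sum is 1 wherever one of the \<open>a j\<close> equals 1, because the product then
  vanishes.\<close>

lemma one_minus_sum_telescope:
  fixes a :: "nat \<Rightarrow> 'b::comm_ring_1"
  shows "1 - (\<Sum>i<n. a i * (\<Prod>j<i. 1 - a j)) = (\<Prod>j<n. 1 - a j)"
proof (induction n)
  case (Suc n)
  have "1 - (\<Sum>i<Suc n. a i * (\<Prod>j<i. 1 - a j)) =
      (1 - (\<Sum>i<n. a i * (\<Prod>j<i. 1 - a j))) - a n * (\<Prod>j<n. 1 - a j)"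
    by simp
  also have "\<dots> = (\<Prod>j<Suc n. 1 - a j)"
    unfolding Suc.IH by (simp add: algebra_simps)
  finally show ?case .
qed simp

text \<open>In the product rule each gradient is multiplied by factors from the unit interval only,
  which do not enlarge it.\<close>

lemma norm_gradient_prod_le:
  fixes f :: "nat \<Rightarrow> 'a::euclidean_space \<Rightarrow> real"
  assumes "\<And>j. C_k 1 (f j)" "\<And>j x. 0 \<le> f j x" "\<And>j x. f j x \<le> 1"
  shows "norm (gradient (\<lambda>x. \<Prod>j<n. 1 - f j x) x) \<le> (\<Sum>j<n. norm (gradient (f j) x))"
proof (induction n)
  case 0
  then show ?case by (simp add: gradient_const)
next
  case (Suc n)
  let ?P = "\<lambda>x. \<Prod>j<n. 1 - f j x"
  have f: "C_k (Suc 0) (f j)" for j using assms(1)[of j] by simp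
  have f1: "C_k (Suc 0) (\<lambda>x. 1 - f j x)" for j by (intro C_k_diff C_k_const f)
  have P: "C_k (Suc 0) ?P" by (intro C_k_prod f1)
  have P01: "0 \<le> ?P x" "?P x \<le> 1" using assms by (auto intro!: prod_nonneg prod_le_1)
  have "gradient (\<lambda>x. \<Prod>j<Suc n. 1 - f j x) x = ?P x *\<^sub>R (- gradient (f n) x) + (1 - f n x) *\<^sub>R gradient ?P x"
    using gradient_mult[OF P f1[of n]] gradient_diff[OF C_k_const[of "Suc 0" 1] f[of n]]
    by (simp add: gradient_const)
  also have "norm \<dots> \<le> \<bar>?P x\<bar> * norm (gradient (f n) x) + \<bar>1 - f n x\<bar> * norm (gradient ?P x)"
    by (rule norm_triangle_le) simp
  also have "\<dots> \<le> 1 * norm (gradient (f n) x) + 1 * norm (gradient ?P x)"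
    using P01 assms(2,3)[of n x] by (intro add_mono mult_right_mono) auto
  finally show ?case using Suc by simp
qed

text \<open>
  The construction of Harvey and Polking. On each dyadic scale only a maximal separated set of
  centres is kept, so that at every point boundedly many bumps of that scale overlap. The bumps
  \<open>f i\<close> are ordered by decreasing radius and \<open>\<theta> i = f i * (\<Prod>j<i. 1 - f j)\<close>; the gradient bounds of
  all earlier bumps then sum up, as a geometric series over the scales, to the bound for the
  scale of \<open>i\<close>.
\<close>

lemma graded_partition_of_unity:
  obtains B :: real where "B \<ge> 0"
    "\<And>S :: ('a::euclidean_space \<times> nat) set. finite S \<Longrightarrow>
      \<exists>n p \<theta>. inj_on p {..<n::nat} \<and> p ` {..<n} \<subseteq> S \<and>
        (\<forall>i k. C_k k (\<theta> i)) \<and> (\<forall>i x. \<bar>\<theta> i x\<bar> \<le> 1) \<and>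
        (\<forall>i x. 3 * (1 / 2) ^ snd (p i) \<le> dist (fst (p i)) x \<longrightarrow> \<theta> i x = 0) \<and>
        (\<forall>i<n. \<forall>x. norm (gradient (\<theta> i) x) \<le> B * 2 ^ snd (p i)) \<and>
        (\<forall>c k x. (c, k) \<in> S \<longrightarrow> dist c x < (1 / 2) ^ k \<longrightarrow> (\<Sum>i<n. \<theta> i x) = 1)"
proof -
  obtain \<psi> :: "'a \<Rightarrow> real \<Rightarrow> 'a \<Rightarrow> real" and B where B: "B \<ge> 0"
    and \<psi>: "\<And>c r k. r > 0 \<Longrightarrow> C_k k (\<psi> c r)" "\<And>c r x. 0 \<le> \<psi> c r x" "\<And>c r x. \<psi> c r x \<le> 1"
    and \<psi>1: "\<And>c r x. r > 0 \<Longrightarrow> dist c x \<le> 2 * r \<Longrightarrow> \<psi> c r x = 1"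
    and \<psi>0: "\<And>c r x. r > 0 \<Longrightarrow> 3 * r \<le> dist c x \<Longrightarrow> \<psi> c r x = 0"
    and d\<psi>: "\<And>c r x. r > 0 \<Longrightarrow> norm (gradient (\<psi> c r) x) \<le> B / r"
    and d\<psi>0: "\<And>c r x. r > 0 \<Longrightarrow> 3 * r < dist c x \<Longrightarrow> gradient (\<psi> c r) x = 0"
    by (rule scaled_bumps, rule that)
  define N :: real where "N = 7 ^ DIM('a)"
  show thesis
  \<comment> \<open>\<open>N\<close> bounds the overlap on one scale, \<open>B\<close> belongs to a
    single bump, and 2 comes from the geometric series over the scales.\<close>
  proof (rule that[of "2 * N * B"])
    fix S :: "('a \<times> nat) set"
    assume S: "finite S"
    define Sk where "Sk k = {c. (c, k) \<in> S}" for k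
    have finSk: "finite (Sk k)" for k
      by (rule finite_subset[of _ "fst ` S"]) (use S in \<open>force simp: Sk_def\<close>)+
    have "\<exists>T\<subseteq>Sk k. (\<forall>x\<in>T. \<forall>y\<in>T. x \<noteq> y \<longrightarrow> (1 / 2) ^ k \<le> dist x y) \<and>
        (\<forall>s\<in>Sk k. \<exists>t\<in>T. dist t s < (1 / 2) ^ k)" (is "\<exists>T\<subseteq>Sk k. ?Q k T") for k
      by (rule separated_subset[OF finSk]) simp
    then have "\<forall>k. \<exists>T. T \<subseteq> Sk k \<and> ?Q k T" by blast
    from choice[OF this] obtain Tk where "\<forall>k. Tk k \<subseteq> Sk k \<and> ?Q k (Tk k)" ..
    then have Tk: "\<And>k. Tk k \<subseteq> Sk k"
      and sep: "\<And>k x y. x \<in> Tk k \<Longrightarrow> y \<in> Tk k \<Longrightarrow> x \<noteq> y \<Longrightarrow> (1 / 2) ^ k \<le> dist x y"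
      and net: "\<And>k s. s \<in> Sk k \<Longrightarrow> \<exists>t\<in>Tk k. dist t s < (1 / 2) ^ k"
      by blast+
    define T where "T = {(c, k). c \<in> Tk k}"
    have TS: "T \<subseteq> S" using Tk by (auto simp: T_def Sk_def)
    then have "finite T" using S finite_subset by blast
    then obtain us where us: "set us = T" "distinct us"
      using finite_distinct_list by blast
    \<comment> \<open>The second component is the exponent of the radius, so increasing order lists
      large radii first.\<close>
    define ts where "ts = sort_key snd us"
    have ts: "set ts = T" "distinct ts" "sorted (map snd ts)"
      using us by (simp_all add: ts_def)
    define n where "n = length ts"
    \<comment> \<open>For \<open>i \<ge> n\<close> this is an unspecified pair. Smoothness, size and
      support of \<open>\<theta> i\<close> hold for any centre and dyadic radius; the gradient bound
      is therefore the one property of a single \<open>\<theta> i\<close> restricted to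
      \<open>i < n\<close>.\<close>
    define p where "p i = ts ! i" for i
    have inj: "inj_on p {..<n}"
      using ts(2) by (auto simp: p_def[abs_def] n_def inj_on_def nth_eq_iff_index_eq)
    have pT: "p ` {..<n} = T"
      unfolding ts(1)[symmetric] set_conv_nth p_def n_def by blast
    have mono: "snd (p j) \<le> snd (p i)" if "j \<le> i" "i < n" for i j
      using sorted_nth_mono[OF ts(3), of j i] that by (simp add: p_def n_def)
    define f where "f i = \<psi> (fst (p i)) ((1 / 2) ^ snd (p i))" for i
    have f: "C_k k (f i)" "0 \<le> f i x" "f i x \<le> 1" for i k x
      using \<psi> by (simp_all add: f_def)
    define \<theta> where "\<theta> i = (\<lambda>x. f i x * (\<Prod>j<i. 1 - f j x))" for i
    have P01: "0 \<le> (\<Prod>j<i. 1 - f j x)" "(\<Prod>j<i. 1 - f j x) \<le> 1" for i x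
      using f by (auto intro!: prod_nonneg prod_le_1)
    have P: "C_k k (\<lambda>x. \<Prod>j<i. 1 - f j x)" for k i
      by (intro C_k_prod C_k_diff C_k_const f)
    have overlap: "(\<Sum>j\<le>i. norm (gradient (f j) x)) \<le> 2 * N * B * 2 ^ snd (p i)" if i: "i < n" for i x
    proof -
      let ?m = "snd (p i)"
      define w where "w = (\<lambda>(c, k). norm (gradient (\<psi> c ((1 / 2) ^ k)) x))"
      \<comment> \<open>Bumps of scale \<open>k\<close> with centre outside \<open>U k\<close> have
        zero gradient at \<open>x\<close>. The set \<open>U k\<close> is separated, so it has at
        most \<open>N\<close> points.\<close>
      define U where "U k = Tk k \<inter> cball x (3 * (1 / 2) ^ k)" for k
      have finT: "finite (Tk k)" for k using finite_subset[OF Tk finSk] .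
      have "(\<Sum>j\<le>i. norm (gradient (f j) x)) = (\<Sum>j\<le>i. w (p j))"
        by (simp add: w_def f_def case_prod_beta)
      also have "\<dots> = sum w (p ` {..i})"
        by (rule sum.reindex[symmetric, unfolded o_def])
          (rule inj_on_subset[OF inj], use i in auto)
      also have "\<dots> \<le> (\<Sum>(c, k)\<in>(\<lambda>(k, c). (c, k)) ` (SIGMA k:{..?m}. Tk k). w (c, k))"
      proof -
        \<comment> \<open>By the ordering, bumps up to index \<open>i\<close> have exponents at most
          \<open>?m\<close>; the sum may be enlarged to all kept centres of these scales.\<close>
        have "p ` {..i} \<subseteq> (\<lambda>(k, c). (c, k)) ` (SIGMA k:{..?m}. Tk k)"
        proof
          fix t assume "t \<in> p ` {..i}"
          then obtain j where j: "j \<le> i" "t = p j" by auto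
          then have "t \<in> T" using pT i by auto
          then show "t \<in> (\<lambda>(k, c). (c, k)) ` (SIGMA k:{..?m}. Tk k)"
            using mono[OF j(1) i] j(2) by (force simp: T_def image_iff)
        qed
        then show ?thesis
          by (auto intro!: sum_mono2 finite_imageI finite_SigmaI finT simp: w_def)
      qed
      also have "\<dots> = (\<Sum>(k, c)\<in>(SIGMA k:{..?m}. Tk k). w (c, k))"
        by (subst sum.reindex) (auto simp: inj_on_def case_prod_beta)
      also have "\<dots> = (\<Sum>k\<le>?m. \<Sum>c\<in>Tk k. w (c, k))"
        by (rule sum.Sigma[symmetric]) (use finT in auto)
      also have "\<dots> \<le> (\<Sum>k\<le>?m. N * (B * 2 ^ k))"
      proof (rule sum_mono)
        fix k
        have "(\<Sum>c\<in>Tk k. w (c, k)) = (\<Sum>c\<in>U k. w (c, k))"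
          by (rule sum.mono_neutral_right)
            (use finT in \<open>auto simp: U_def w_def dist_commute[of x] not_le intro!: d\<psi>0\<close>)
        also have "\<dots> \<le> real (card (U k)) * (B * 2 ^ k)"
          using d\<psi>[of "(1 / 2) ^ k"] by (intro sum_bounded_above) (auto simp: w_def power_one_over)
        also have "\<dots> \<le> N * (B * 2 ^ k)"
          unfolding N_def using B
          by (intro mult_right_mono card_separated_le[of _ "(1 / 2) ^ k" x])
            (auto simp: U_def finT intro: sep)
        finally show "(\<Sum>c\<in>Tk k. w (c, k)) \<le> N * (B * 2 ^ k)" .
      qed
      also have "\<dots> = N * B * (\<Sum>k\<le>?m. 2 ^ k)"
        by (simp add: sum_distrib_left mult.assoc)
      also have "\<dots> \<le> N * B * (2 * 2 ^ ?m)"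
      proof (rule mult_left_mono)
        have "(\<Sum>k\<le>m. 2 ^ k) \<le> (2 * 2 ^ m :: real)" for m by (induction m) auto
        then show "(\<Sum>k\<le>?m. 2 ^ k) \<le> (2 * 2 ^ ?m :: real)" .
      qed (use B in \<open>simp add: N_def\<close>)
      finally show ?thesis by (simp add: mult_ac)
    qed
    have "norm (gradient (\<theta> i) x) \<le> 2 * N * B * 2 ^ snd (p i)" if "i < n" for i x
    proof -
      let ?P = "\<lambda>x. \<Prod>j<i. 1 - f j x"
      have "gradient (\<theta> i) x = f i x *\<^sub>R gradient ?P x + ?P x *\<^sub>R gradient (f i) x"
        unfolding \<theta>_def by (rule gradient_mult[OF f(1)[of "Suc 0"] P[of "Suc 0"]])
      also have "norm \<dots> \<le> \<bar>f i x\<bar> * norm (gradient ?P x) + \<bar>?P x\<bar> * norm (gradient (f i) x)"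
        by (rule norm_triangle_le) simp
      also have "\<dots> \<le> 1 * (\<Sum>j<i. norm (gradient (f j) x)) + 1 * norm (gradient (f i) x)"
        using P01 f by (intro add_mono mult_mono norm_gradient_prod_le) (auto simp: sum_nonneg)
      also have "\<dots> = (\<Sum>j\<le>i. norm (gradient (f j) x))"
        by (simp add: lessThan_Suc_atMost[symmetric])
      also note overlap[OF that]
      finally show ?thesis .
    qed
    moreover have "(\<Sum>i<n. \<theta> i x) = 1" if ck: "(c, k) \<in> S" "dist c x < (1 / 2) ^ k" for c k x
    proof -
      obtain t where t: "t \<in> Tk k" "dist t c < (1 / 2) ^ k"
        using net[of c k] ck by (auto simp: Sk_def)
      then have "(t, k) \<in> p ` {..<n}" using pT by (simp add: T_def)
      then obtain i where i: "i < n" "p i = (t, k)" by auto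
      \<comment> \<open>The kept centre \<open>t\<close> is within one radius of \<open>c\<close>
        and \<open>c\<close> within one radius of \<open>x\<close>. This is why the bumps equal 1 on
        the ball of twice the radius.\<close>
      have "f i x = 1"
        unfolding f_def i using ck(2) t(2) dist_triangle[of t x c]
        by (intro \<psi>1) auto
      then have zero: "(\<Prod>j<n. 1 - f j x) = 0" using i by auto
      show ?thesis
        using one_minus_sum_telescope[of "\<lambda>i. f i x" n, unfolded zero] by (simp add: \<theta>_def)
    qed
    moreover have "\<bar>\<theta> i x\<bar> \<le> 1" for i x
      using P01[of x i] f(2,3)[of i x] by (auto simp: \<theta>_def abs_mult intro!: mult_le_one)
    moreover have "C_k k (\<theta> i)" for i k
      unfolding \<theta>_def by (intro C_k_mult f P)
    moreover have "\<theta> i x = 0" if "3 * (1 / 2) ^ snd (p i) \<le> dist (fst (p i)) x" for i x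
      using that \<psi>0 by (simp add: \<theta>_def f_def)
    ultimately show "\<exists>n p \<theta>. inj_on p {..<n::nat} \<and> p ` {..<n} \<subseteq> S \<and>
        (\<forall>i k. C_k k (\<theta> i)) \<and> (\<forall>i x. \<bar>\<theta> i x\<bar> \<le> 1) \<and>
        (\<forall>i x. 3 * (1 / 2) ^ snd (p i) \<le> dist (fst (p i)) x \<longrightarrow> \<theta> i x = 0) \<and>
        (\<forall>i<n. \<forall>x. norm (gradient (\<theta> i) x) \<le> 2 * N * B * 2 ^ snd (p i)) \<and>
        (\<forall>c k x. (c, k) \<in> S \<longrightarrow> dist c x < (1 / 2) ^ k \<longrightarrow> (\<Sum>i<n. \<theta> i x) = 1)"
      using inj pT TS by (intro exI[of _ n] exI[of _ p] exI[of _ \<theta>]) simp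
  qed (use B in \<open>simp add: N_def\<close>)
qed

section \<open>Dyadic covers of Hausdorff null sets\<close>

lemma hausdorff_null_covers:
  assumes "hausdorff_measure s E = 0" "\<delta> > 0" "e > 0"
  obtains C where "E \<subseteq> (\<Union>i. C i)" "\<And>i::nat. bounded (C i)" "\<And>i. diameter (C i) \<le> \<delta>"
    "(\<Sum>i. hausdorff_weight s (C i)) < e"
proof -
  have "hausdorff_premeasure s \<delta> E \<le> hausdorff_measure s E"
    unfolding hausdorff_measure_def using assms(2) by (intro SUP_upper) simp
  then have "hausdorff_premeasure s \<delta> E < e" using assms by simp
  then show thesis
    unfolding hausdorff_premeasure_def INF_less_iff using that by blast
qed

text \<open>Every nonempty set has weight 1, so a cover of total weight below 1 consists of empty
  sets.\<close>

lemma hausdorff_measure_0_eq_0: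
  assumes "hausdorff_measure 0 E = 0" shows "E = {}"
proof -
  obtain C where C: "E \<subseteq> (\<Union>i. C i)" "(\<Sum>i. hausdorff_weight 0 (C i)) < 1"
    by (rule hausdorff_null_covers[OF assms zero_less_one zero_less_one], rule that)
  have "C i = {}" for i
  proof (rule ccontr)
    assume "C i \<noteq> {}"
    then have "1 = (\<Sum>i\<in>{i}. hausdorff_weight 0 (C i))" by (simp add: hausdorff_weight_def)
    also have "\<dots> \<le> (\<Sum>i. hausdorff_weight 0 (C i))" by (rule sum_le_suminf) auto
    finally show False using C(2) by simp
  qed
  then show ?thesis using C(1) by auto
qed

text \<open>\<open>k\<close> is the predecessor of the least exponent \<open>m\<close> with
  \<open>(1 / 2) ^ m \<le> \<rho>\<close>; since \<open>\<rho> < 1\<close>, this \<open>m\<close> is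
  not 0.\<close>

lemma dyadic_bracket:
  fixes \<rho> :: real
  assumes "0 < \<rho>" "\<rho> < 1"
  obtains k where "\<rho> < (1 / 2) ^ k" "(1 / 2) ^ k \<le> 2 * \<rho>"
proof -
  have ex: "\<exists>n. (1 / 2) ^ n \<le> \<rho>"
    using real_arch_pow_inv[OF assms(1), of "1 / 2"] by (auto intro: less_imp_le)
  define m where "m = (LEAST n. (1 / 2) ^ n \<le> \<rho>)"
  have m: "(1 / 2) ^ m \<le> \<rho>" unfolding m_def using ex by (rule LeastI_ex)
  then obtain k where k: "m = Suc k" using assms(2) by (cases m) auto
  then have "\<not> (1 / 2) ^ k \<le> \<rho>" unfolding m_def using not_less_Least by (metis lessI)
  then show thesis using that[of k] m k by simp
qed

text \<open>Each covering set that meets \<open>E\<close> lies in an open ball about one of its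
  points in \<open>E\<close>, with a dyadic radius comparable to its padded diameter; compactness
  then leaves finitely many balls.\<close>

lemma hausdorff_null_dyadic_cover:
  fixes E :: "'a::metric_space set"
  assumes "compact E" "s > 0" "hausdorff_measure s E = 0" "e > 0"
  obtains S :: "('a \<times> nat) set" where "finite S" "fst ` S \<subseteq> E"
    "E \<subseteq> (\<Union>(c, k)\<in>S. ball c ((1 / 2) ^ k))" "(\<Sum>(c, k)\<in>S. ((1 / 2) ^ k) powr s) \<le> e"
proof -
  define \<omega> where "\<omega> = unit_ball_vol s"
  have \<omega>: "\<omega> > 0" using assms(2) by (simp add: \<omega>_def)
  \<comment> \<open>Diameters and padding shall each contribute at most \<open>e / 2\<close>. The
    factor \<open>8 powr s\<close> is \<open>2 powr s\<close>, from the half diameters in the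
    weight, times \<open>4 powr s\<close>, from the passage to dyadic radii. The second bound in
    \<open>e2\<close> keeps the padding below 1/2.\<close>
  define e1 where "e1 = e / (2 * 8 powr s)"
  define e2 where "e2 = min (e / (2 * 4 powr s)) ((1 / 4) powr s)"
  have e12: "e1 > 0" "e2 > 0" using assms(4) by (auto simp: e1_def e2_def)
  obtain C where C: "E \<subseteq> (\<Union>i. C i)" "\<And>i::nat. bounded (C i)" "\<And>i. diameter (C i) \<le> 1 / 4"
    "(\<Sum>i. hausdorff_weight s (C i)) < ennreal (\<omega> * e1)"
    using hausdorff_null_covers[OF assms(3), of "1 / 4" "ennreal (\<omega> * e1)"] \<omega> e12 by auto
  define d where "d i = diameter (C i)" for i
  have d: "0 \<le> d i" "d i \<le> 1 / 4" for i
    using C(2,3) diameter_ge_0 by (auto simp: d_def)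
  have weight: "hausdorff_weight s (C i) = ennreal (\<omega> * (d i / 2) powr s)" for i
    using assms(2) by (simp add: hausdorff_weight_def \<omega>_def d_def)
  have sum_d: "(\<Sum>i\<in>J. d i powr s) \<le> 2 powr s * e1" if "finite J" for J
  proof -
    have "ennreal (\<Sum>i\<in>J. \<omega> * (d i / 2) powr s) = (\<Sum>i\<in>J. hausdorff_weight s (C i))"
      unfolding weight using \<omega> by (intro sum_ennreal[symmetric]) simp
    also have "\<dots> \<le> (\<Sum>i. hausdorff_weight s (C i))" using that by (intro sum_le_suminf) auto
    also note C(4)
    finally have "(\<Sum>i\<in>J. \<omega> * (d i / 2) powr s) \<le> \<omega> * e1"
      using \<omega> e12 by (simp add: ennreal_less_iff sum_nonneg)
    then have "(\<Sum>i\<in>J. (d i / 2) powr s) \<le> e1"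
      using \<omega> by (simp add: sum_distrib_left[symmetric])
    moreover have "d i powr s = 2 powr s * (d i / 2) powr s" for i
      using d(1)[of i] by (simp add: powr_mult[symmetric])
    ultimately show ?thesis by (simp add: sum_distrib_left[symmetric])
  qed
  \<comment> \<open>The covering sets may have diameter zero, so their diameters are padded by \<open>\<eta> i > 0\<close>.\<close>
  define \<eta> where "\<eta> i = (e2 * (1 / 2) ^ Suc i) powr (1 / s)" for i :: nat
  have \<eta>s: "\<eta> i powr s = e2 * (1 / 2) ^ Suc i" for i
    using e12 assms(2) by (simp add: \<eta>_def powr_powr)
  have \<eta>0: "\<eta> i > 0" for i using e12 by (simp add: \<eta>_def)
  have \<eta>1: "\<eta> i < 1 / 2" for i
  proof -
    have "(1 / 2 :: real) ^ Suc i \<le> 1" by (rule power_le_one) auto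
    then have "\<eta> i powr s \<le> e2 * 1" unfolding \<eta>s using e12 by (intro mult_left_mono) auto
    also have "\<dots> < (1 / 2) powr s"
      using powr_less_mono2[of s "1 / 4" "1 / 2"] assms(2) by (simp add: e2_def min_def)
    finally show ?thesis
      using powr_mono2[of s "1 / 2" "\<eta> i"] assms(2) by (simp add: not_le[symmetric]) (meson leD leI)
  qed
  have sum_\<eta>: "(\<Sum>i\<in>J. \<eta> i powr s) \<le> e2" if "finite J" for J
  proof -
    have "(\<Sum>i\<in>J. (1 / 2 :: real) ^ Suc i) \<le> (\<Sum>i. (1 / 2) ^ Suc i)"
      using power_half_series that by (intro sum_le_suminf) (auto simp: sums_iff)
    also have "\<dots> = 1" using power_half_series by (simp add: sums_iff)
    finally show ?thesis
      unfolding \<eta>s sum_distrib_left[symmetric] using e12 by simp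
  qed
  \<comment> \<open>The factor 2 and the positive padding make \<open>\<rho> i\<close> strictly
    larger than \<open>d i\<close>, as open balls require, while \<open>\<rho> i < 1\<close> permits
    the dyadic bracket.\<close>
  define \<rho> where "\<rho> i = 2 * max (d i) (\<eta> i)" for i
  have \<rho>: "0 < \<rho> i" "\<rho> i < 1" "d i < \<rho> i" for i
    using \<eta>0[of i] \<eta>1[of i] d[of i] by (auto simp: \<rho>_def)
  have "\<exists>k. \<rho> i < (1 / 2) ^ k \<and> (1 / 2) ^ k \<le> 2 * \<rho> i" for i
    using dyadic_bracket[OF \<rho>(1,2)] by blast
  then have "\<forall>i. \<exists>k. \<rho> i < (1 / 2) ^ k \<and> (1 / 2) ^ k \<le> 2 * \<rho> i" by blast
  from choice[OF this] obtain k where k: "\<And>i. \<rho> i < (1 / 2) ^ k i" "\<And>i. (1 / 2) ^ k i \<le> 2 * \<rho> i"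
    by blast
  define I where "I = {i. C i \<inter> E \<noteq> {}}"
  have "\<forall>i\<in>I. \<exists>x. x \<in> C i \<inter> E" by (auto simp: I_def)
  from bchoice[OF this] obtain x where x: "\<And>i. i \<in> I \<Longrightarrow> x i \<in> C i \<inter> E" by blast
  have "E \<subseteq> (\<Union>i\<in>I. ball (x i) ((1 / 2) ^ k i))"
  proof
    fix y assume y: "y \<in> E"
    then obtain i where i: "y \<in> C i" using C(1) by auto
    with y have iI: "i \<in> I" by (auto simp: I_def)
    then have "dist (x i) y \<le> d i"
      unfolding d_def using x i C(2) by (intro diameter_bounded_bound) auto
    then have "y \<in> ball (x i) ((1 / 2) ^ k i)" using \<rho>(3)[of i] k(1)[of i] by simp
    with iI show "y \<in> (\<Union>i\<in>I. ball (x i) ((1 / 2) ^ k i))" by blast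
  qed
  then obtain J where J: "J \<subseteq> I" "finite J" "E \<subseteq> (\<Union>i\<in>J. ball (x i) ((1 / 2) ^ k i))"
    using compactE_image[OF assms(1), of I "\<lambda>i. ball (x i) ((1 / 2) ^ k i)"] by auto
  have each: "((1 / 2) ^ k i) powr s \<le> 4 powr s * (d i powr s + \<eta> i powr s)" for i
  proof -
    have "((1 / 2) ^ k i) powr s \<le> (4 * max (d i) (\<eta> i)) powr s"
      using k(2)[of i] assms(2) by (intro powr_mono2) (auto simp: \<rho>_def)
    also have "\<dots> = 4 powr s * max (d i) (\<eta> i) powr s"
      by (rule powr_mult)
    also have "\<dots> \<le> 4 powr s * (d i powr s + \<eta> i powr s)"
      by (intro mult_left_mono) (auto simp: max_def)
    finally show ?thesis .
  qed
  show thesis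
  proof (rule that[of "(\<lambda>i. (x i, k i)) ` J"])
    show "fst ` (\<lambda>i. (x i, k i)) ` J \<subseteq> E" using x J(1) by auto
    \<comment> \<open>Only an inequality, as different indices may give the same ball.\<close>
    have "(\<Sum>(c, k)\<in>(\<lambda>i. (x i, k i)) ` J. ((1 / 2) ^ k) powr s)
        \<le> (\<Sum>i\<in>J. ((1 / 2) ^ k i) powr s)"
      using sum_image_le[OF J(2), of "\<lambda>(c, k). ((1 / 2) ^ k) powr s" "\<lambda>i. (x i, k i)"]
      by (simp add: o_def)
    also have "\<dots> \<le> (\<Sum>i\<in>J. 4 powr s * (d i powr s + \<eta> i powr s))"
      by (intro sum_mono each)
    also have "\<dots> = 4 powr s * ((\<Sum>i\<in>J. d i powr s) + (\<Sum>i\<in>J. \<eta> i powr s))"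
      by (simp only: sum.distrib[symmetric] sum_distrib_left)
    also have "\<dots> \<le> 4 powr s * (2 powr s * e1 + e / (2 * 4 powr s))"
      using sum_d[OF J(2)] sum_\<eta>[OF J(2)] by (intro mult_left_mono add_mono) (auto simp: e2_def)
    also have "\<dots> = (4 powr s * 2 powr s) * e1 + e / 2"
      by (simp add: algebra_simps)
    also have "\<dots> = e"
      by (simp add: powr_mult[symmetric] e1_def)
    finally show "(\<Sum>(c, k)\<in>(\<lambda>i. (x i, k i)) ` J. ((1 / 2) ^ k) powr s) \<le> e" .
  qed (use J in auto)
qed

section \<open>The defect of the weak equation\<close>

text \<open>
  By translation invariance every difference quotient of \<open>u\<close> has integral zero; dominated
  convergence passes to the derivative.
\<close>

lemma integral_gradient_eq_0:
  fixes u :: "'a::euclidean_space \<Rightarrow> real"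
  assumes u: "C_k 1 u" and K: "compact K" "\<And>x. x \<notin> K \<Longrightarrow> u x = 0"
  shows "(LINT x|lborel. gradient u x \<bullet> v) = 0"
proof -
  have u': "C_k (Suc 0) u" using u by simp
  have cu: "continuous_on UNIV u" by (rule C_k_imp_continuous[OF u])
  have gz: "gradient u x = 0" if "x \<notin> K" for x
    by (rule gradient_zero[where S="- K"]) (use K that in \<open>auto simp: compact_imp_closed open_Compl\<close>)
  have "compact (gradient u ` K)"
    by (intro compact_continuous_image continuous_on_subset[OF C_k_gradient_continuous[OF u']] K) auto
  then have "bounded (gradient u ` K)" by (rule compact_imp_bounded)
  then obtain L where L0: "\<And>x. x \<in> K \<Longrightarrow> norm (gradient u x) \<le> L"
    unfolding bounded_iff by blast
  \<comment> \<open>If \<open>K\<close> is empty, \<open>L\<close> could be negative.\<close>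
  define L' where "L' = max L 0"
  have L: "norm (gradient u x) \<le> L'" for x
    using L0[of x] gz[of x] by (cases "x \<in> K") (auto simp: L'_def)
  have lip: "\<bar>u x - u y\<bar> \<le> L' * norm (x - y)" for x y
  proof -
    have "norm (u x - u y) \<le> L' * norm (x - y)"
    proof (rule differentiable_bound[OF convex_UNIV])
      show "(u has_derivative (\<lambda>h. h \<bullet> gradient u x)) (at x within UNIV)" for x
        using C_k_GDERIV[OF u', of x] by (simp add: gderiv_def)
      show "onorm (\<lambda>h. h \<bullet> gradient u x) \<le> L'" for x
      proof (rule onorm_le)
        fix h
        have "norm (h \<bullet> gradient u x) \<le> norm h * norm (gradient u x)"
          by (simp add: Cauchy_Schwarz_ineq2)
        also have "\<dots> \<le> norm h * L'" by (intro mult_left_mono L) simp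
        finally show "norm (h \<bullet> gradient u x) \<le> L' * norm h" by (simp add: mult.commute)
      qed
    qed auto
    then show ?thesis by simp
  qed
  obtain R where R: "K \<subseteq> cball 0 R"
    using compact_imp_bounded[OF K(1)] by (auto simp: bounded_iff subset_iff)
  have int_u: "integrable lborel u"
  proof -
    have "integrable lborel (\<lambda>x. indicator K x *\<^sub>R u x)"
      by (rule borel_integrable_compact[OF K(1)]) (rule continuous_on_subset[OF cu], simp)
    moreover have "(\<lambda>x. indicator K x *\<^sub>R u x) = u"
      using K(2) by (intro ext) (auto simp: indicator_def)
    ultimately show ?thesis by simp
  qed
  define c where "c n = inverse (real (Suc n))" for n
  have c: "c n > 0" "c n \<le> 1" for n
    by (simp_all add: c_def inverse_le_1_iff)
  have c0: "c \<longlonglongrightarrow> 0"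
    unfolding c_def by (rule LIMSEQ_inverse_real_of_nat)
  have shift: "integrable lborel (\<lambda>x. u (w + x))" "(LINT x|lborel. u (w + x)) = (LINT x|lborel. u x)" for w
  proof -
    have *: "u \<in> borel_measurable borel" "(+) w \<in> lborel \<rightarrow>\<^sub>M borel"
      using borel_measurable_continuous_onI[OF cu] by simp_all
    show "integrable lborel (\<lambda>x. u (w + x))"
      using integrable_distr_eq[OF *(2,1)] int_u by (simp only: lborel_distr_plus)
    show "(LINT x|lborel. u (w + x)) = (LINT x|lborel. u x)"
      using integral_distr[OF *(2,1)] by (simp only: lborel_distr_plus)
  qed
  define s where "s n x = (u (c n *\<^sub>R v + x) - u x) / c n" for n x
  \<comment> \<open>As \<open>c n \<le> 1\<close>, all quotients vanish outside the ball of radius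
    \<open>R + norm v\<close>, and the Lipschitz bound gives \<open>L' * norm v\<close> inside it;
    this yields the dominating function.\<close>
  have "(\<lambda>n. LINT x|lborel. s n x) \<longlonglongrightarrow> (LINT x|lborel. gradient u x \<bullet> v)"
  proof (rule integral_dominated_convergence[where w = "\<lambda>x. indicator (cball 0 (R + norm v)) x *\<^sub>R (L' * norm v)"])
    show "(\<lambda>x. gradient u x \<bullet> v) \<in> borel_measurable lborel"
      using C_k_gradient_continuous[OF u']
      by (auto intro!: borel_measurable_continuous_onI continuous_on_inner continuous_on_const simp: measurable_lborel1)
    show "s n \<in> borel_measurable lborel" for n
    proof -
      have "continuous_on UNIV (s n)"
        unfolding s_def using c(1)[of n]
        by (auto intro!: continuous_intros continuous_on_compose2[OF cu])
      then show ?thesis by (simp add: borel_measurable_continuous_onI)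
    qed
    show "integrable lborel (\<lambda>x. indicator (cball 0 (R + norm v)) x *\<^sub>R (L' * norm v))"
      by (rule borel_integrable_compact) auto
    show "AE x in lborel. (\<lambda>n. s n x) \<longlonglongrightarrow> gradient u x \<bullet> v"
    proof (rule AE_I2)
      fix x :: 'a
      have "((\<lambda>t. u (t *\<^sub>R v + x)) has_derivative (\<lambda>t. (t *\<^sub>R v) \<bullet> gradient u (0 *\<^sub>R v + x))) (at 0)"
        by (rule has_derivative_compose[of "\<lambda>t. t *\<^sub>R v + x" "\<lambda>t. t *\<^sub>R v" 0 UNIV u])
          (use C_k_GDERIV[OF u', of x] in \<open>auto intro!: derivative_eq_intros simp: gderiv_def\<close>)
      then have "((\<lambda>t. u (t *\<^sub>R v + x)) has_real_derivative gradient u x \<bullet> v) (at 0)"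
        by (simp add: has_field_derivative_def inner_commute mult_commute_abs)
      then have "((\<lambda>t. (u (t *\<^sub>R v + x) - u x) / t) \<longlongrightarrow> gradient u x \<bullet> v) (at 0)"
        by (simp add: DERIV_def)
      moreover have "filterlim c (at 0) sequentially"
        using c0 c(1) by (simp add: filterlim_at less_imp_neq[THEN not_sym])
      ultimately show "(\<lambda>n. s n x) \<longlonglongrightarrow> gradient u x \<bullet> v"
        unfolding s_def by (rule filterlim_compose)
    qed
    show "AE x in lborel. norm (s n x) \<le> indicator (cball 0 (R + norm v)) x *\<^sub>R (L' * norm v)" for n
    proof (rule AE_I2)
      fix x :: 'a
      show "norm (s n x) \<le> indicator (cball 0 (R + norm v)) x *\<^sub>R (L' * norm v)"
      proof (cases "x \<in> cball 0 (R + norm v)")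
        case True
        have "\<bar>u (c n *\<^sub>R v + x) - u x\<bar> \<le> L' * norm v * c n"
          using lip[of "c n *\<^sub>R v + x" x] c(1)[of n] by (simp add: ac_simps)
        then show ?thesis using True c(1)[of n] by (simp add: s_def field_simps)
      next
        case False
        have "norm x \<le> norm (c n *\<^sub>R v + x) + norm (c n *\<^sub>R v)"
          using norm_triangle_ineq4[of "c n *\<^sub>R v + x" "c n *\<^sub>R v"] by simp
        also have "norm (c n *\<^sub>R v) \<le> norm v"
          using c[of n] by (simp add: mult_left_le_one_le)
        finally have "norm (c n *\<^sub>R v + x) > R" using False by simp
        moreover have "norm x > R" using False norm_ge_zero[of v] by (simp del: norm_ge_zero)
        ultimately have "x \<notin> K" "c n *\<^sub>R v + x \<notin> K" using R by auto
        then show ?thesis using K(2) False by (simp add: s_def indicator_def)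
      qed
    qed
  qed
  moreover have "(LINT x|lborel. s n x) = 0" for n
    unfolding s_def using shift int_u by simp
  ultimately have "(\<lambda>n. 0) \<longlonglongrightarrow> (LINT x|lborel. gradient u x \<bullet> v)" by simp
  then show ?thesis by (simp add: LIMSEQ_const_iff)
qed

section \<open>Hoelder bounds and integrals of compactly supported functions\<close>

lemma holder_on_imp_continuous_on:
  assumes "holder_on \<alpha> A F" "0 \<le> \<alpha>"
  shows "continuous_on A F"
proof (cases "\<alpha> = 0")
  case False
  then obtain C where C: "\<And>x y. x \<in> A \<Longrightarrow> y \<in> A \<Longrightarrow> norm (F x - F y) \<le> C * norm (x - y) powr \<alpha>"
    using assms(1) by (auto simp: holder_on_def)
  show ?thesis
    unfolding continuous_on_def
  proof
    fix x assume x: "x \<in> A"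
    have "((\<lambda>y. norm (y - x)) \<longlongrightarrow> 0) (at x within A)"
      using tendsto_norm_zero[OF LIM_zero[OF tendsto_ident_at]] .
    then have "((\<lambda>y. C * norm (y - x) powr \<alpha>) \<longlongrightarrow> C * 0) (at x within A)"
      using False assms(2)
      by (intro tendsto_mult tendsto_const tendsto_zero_powrI[of _ _ _ \<alpha>]) auto
    then have lim: "((\<lambda>y. C * norm (y - x) powr \<alpha>) \<longlongrightarrow> 0) (at x within A)" by simp
    have "\<forall>\<^sub>F y in at x within A. norm (F y - F x) \<le> C * norm (y - x) powr \<alpha>"
      using C x by (simp add: eventually_at_filter)
    from Lim_null_comparison[OF this lim]
    have "((\<lambda>y. F y - F x) \<longlongrightarrow> 0) (at x within A)" .
    then show "(F \<longlongrightarrow> F x) (at x within A)" by (rule LIM_zero_cancel)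
  qed
qed (use assms in \<open>simp add: holder_on_def\<close>)

text \<open>Makes the cases \<open>\<alpha> = 0\<close> and \<open>\<alpha> > 0\<close> uniform: for
  \<open>\<alpha> = 0\<close> the factor \<open>r powr \<alpha>\<close> is 1, and boundedness of
  \<open>F\<close> on the compact set \<open>K\<close> suffices.\<close>

lemma holder_on_bound_dist_le:
  fixes F :: "'a::euclidean_space \<Rightarrow> 'b::euclidean_space"
  assumes "holder_on \<alpha> A F" "0 \<le> \<alpha>" "compact K" "K \<subseteq> A" "M > 0"
  obtains H where "H \<ge> 0"
    "\<And>c x r. c \<in> K \<Longrightarrow> x \<in> K \<Longrightarrow> 0 < r \<Longrightarrow> dist c x \<le> M * r \<Longrightarrow> norm (F x - F c) \<le> H * r powr \<alpha>"
proof (cases "\<alpha> = 0")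
  case True
  have "compact (F ` K)"
    by (rule compact_continuous_image[OF continuous_on_subset[OF
          holder_on_imp_continuous_on[OF assms(1,2)] assms(4)] assms(3)])
  then have "bounded (F ` K)" by (rule compact_imp_bounded)
  then obtain b where b: "\<And>x. x \<in> K \<Longrightarrow> norm (F x) \<le> b"
    unfolding bounded_iff by blast
  show thesis
  proof (rule that[of "2 * max b 0"])
    fix c x and r :: real assume *: "c \<in> K" "x \<in> K" "0 < r"
    have "norm (F x - F c) \<le> norm (F x) + norm (F c)" by (rule norm_triangle_ineq4)
    then show "norm (F x - F c) \<le> 2 * max b 0 * r powr \<alpha>"
      using b[OF *(1)] b[OF *(2)] *(3) True by simp
  qed simp
next
  case False
  then obtain C where C: "\<And>x y. x \<in> A \<Longrightarrow> y \<in> A \<Longrightarrow> norm (F x - F y) \<le> C * norm (x - y) powr \<alpha>"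
    using assms(1) by (auto simp: holder_on_def)
  show thesis
  proof (rule that[of "\<bar>C\<bar> * M powr \<alpha>"])
    fix c x and r :: real assume *: "c \<in> K" "x \<in> K" "0 < r" "dist c x \<le> M * r"
    have "norm (F x - F c) \<le> C * norm (x - c) powr \<alpha>" using C * assms(4) by blast
    also have "\<dots> \<le> \<bar>C\<bar> * (M * r) powr \<alpha>"
      using * assms(2) by (intro mult_mono powr_mono2) (auto simp: dist_norm norm_minus_commute)
    also have "\<dots> = \<bar>C\<bar> * M powr \<alpha> * r powr \<alpha>"
      using * assms(5) by (simp add: powr_mult)
    finally show "norm (F x - F c) \<le> \<bar>C\<bar> * M powr \<alpha> * r powr \<alpha>" .
  qed simp
qed

lemma integrable_supported:
  fixes f :: "'a::euclidean_space \<Rightarrow> real"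
  assumes "compact K" "continuous_on K f" "\<And>x. x \<notin> K \<Longrightarrow> f x = 0"
  shows "integrable lborel f"
proof -
  have "integrable lborel (\<lambda>x. indicator K x *\<^sub>R f x)"
    by (rule borel_integrable_compact[OF assms(1,2)])
  also have "(\<lambda>x. indicator K x *\<^sub>R f x) = f"
    using assms(3) by (intro ext) (auto simp: indicator_def)
  finally show ?thesis .
qed

lemma set_integral_supported:
  fixes f :: "'a::euclidean_space \<Rightarrow> real"
  assumes "\<And>x. x \<notin> A \<Longrightarrow> f x = 0"
  shows "(LINT x:A|lborel. f x) = (LINT x|lborel. f x)"
proof -
  have "(\<lambda>x. indicator A x *\<^sub>R f x) = f"
    using assms by (intro ext) (auto simp: indicator_def)
  then show ?thesis by (simp add: set_lebesgue_integral_def)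
qed

lemma abs_integral_le_cball:
  fixes f :: "'a::euclidean_space \<Rightarrow> real"
  assumes "integrable lborel f" "\<And>x. \<bar>f x\<bar> \<le> M" "\<And>x. \<rho> < dist c x \<Longrightarrow> f x = 0" "0 \<le> \<rho>"
  shows "\<bar>LINT x|lborel. f x\<bar> \<le> M * (unit_ball_vol DIM('a) * \<rho> ^ DIM('a))"
proof -
  have "\<bar>LINT x|lborel. f x\<bar> \<le> (LINT x|lborel. \<bar>f x\<bar>)"
    using integral_abs_bound .
  also have "\<dots> \<le> (LINT x|lborel. M * indicator (cball c \<rho>) x)"
  proof (rule integral_mono)
    show "integrable lborel (\<lambda>x. M * indicator (cball c \<rho>) x)"
      using emeasure_lborel_cball_finite[of c \<rho>] by simp
    show "\<bar>f x\<bar> \<le> M * indicator (cball c \<rho>) x" for x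
      using assms(2,3)[of x] by (auto simp: indicator_def)
  qed (use assms(1) in simp)
  also have "\<dots> = M * (unit_ball_vol DIM('a) * \<rho> ^ DIM('a))"
    using assms(4) by (simp add: content_cball)
  finally show ?thesis .
qed

text \<open>The weak equation on \<open>U\<close> says that this functional vanishes on the test
  functions of \<open>U\<close>.\<close>

definition weak_defect ::
    "'a::euclidean_space set \<Rightarrow> ('a \<Rightarrow> 'a) \<Rightarrow> ('a \<Rightarrow> real) \<Rightarrow> ('a \<Rightarrow> real) \<Rightarrow> real" where
  "weak_defect U F g u = (LINT x:U|lborel. F x \<bullet> gradient u x) - (LINT x:U|lborel. g x * u x)"

text \<open>Both integrands vanish off \<open>K\<close>, so the domain \<open>U\<close> can be
  replaced by the whole space. In particular the defects over two open sets that contain the support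
  agree.\<close>

lemma weak_defect_integrals:
  assumes K: "compact K" "K \<subseteq> U" "continuous_on K F" "continuous_on K g"
    and u: "C_k 1 u" "{x. u x \<noteq> 0} \<subseteq> K"
  shows "integrable lborel (\<lambda>x. F x \<bullet> gradient u x)" "integrable lborel (\<lambda>x. g x * u x)"
    "weak_defect U F g u = (LINT x|lborel. F x \<bullet> gradient u x) - (LINT x|lborel. g x * u x)"
    "\<And>x. x \<notin> K \<Longrightarrow> gradient u x = 0"
proof -
  have u': "C_k (Suc 0) u" using u(1) by simp
  have u0: "u x = 0" if "x \<notin> K" for x using u(2) that by auto
  show gz: "gradient u x = 0" if "x \<notin> K" for x
    by (rule gradient_zero[of "- K"]) (use K(1) u0 that in \<open>auto simp: compact_imp_closed open_Compl\<close>)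
  show "integrable lborel (\<lambda>x. F x \<bullet> gradient u x)"
    by (rule integrable_supported[OF K(1) continuous_on_inner[OF K(3)
          continuous_on_subset[OF C_k_gradient_continuous[OF u'] subset_UNIV]]]) (simp add: gz)
  show "integrable lborel (\<lambda>x. g x * u x)"
    by (rule integrable_supported[OF K(1) continuous_on_mult[OF K(4)
          continuous_on_subset[OF C_k_imp_continuous[OF u(1)] subset_UNIV]]]) (simp add: u0)
  have "F x \<bullet> gradient u x = 0" "g x * u x = 0" if "x \<notin> U" for x
  proof -
    have "x \<notin> K" using K(2) that by auto
    then show "F x \<bullet> gradient u x = 0" "g x * u x = 0" by (simp_all add: gz u0)
  qed
  then show "weak_defect U F g u = (LINT x|lborel. F x \<bullet> gradient u x) - (LINT x|lborel. g x * u x)"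
    unfolding weak_defect_def by (simp add: set_integral_supported)
qed

lemma weak_defect_add:
  assumes K: "compact K" "K \<subseteq> U" "continuous_on K F" "continuous_on K g"
    and u: "C_k 1 u" "{x. u x \<noteq> 0} \<subseteq> K"
    and v: "C_k 1 v" "{x. v x \<noteq> 0} \<subseteq> K"
  shows "weak_defect U F g (\<lambda>x. u x + v x) = weak_defect U F g u + weak_defect U F g v"
proof -
  have "{x. u x + v x \<noteq> 0} \<subseteq> {x. u x \<noteq> 0} \<union> {x. v x \<noteq> 0}" by auto
  with u(2) v(2) have supp: "{x. u x + v x \<noteq> 0} \<subseteq> K" by blast
  note uv = C_k_add[OF u(1) v(1)] supp
  have g: "gradient (\<lambda>x. u x + v x) x = gradient u x + gradient v x" for x
    using u(1) v(1) by (intro gradient_add[of 0 _ 0]) simp_all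
  have "weak_defect U F g (\<lambda>x. u x + v x) =
      (LINT x|lborel. F x \<bullet> gradient u x + F x \<bullet> gradient v x) - (LINT x|lborel. g x * u x + g x * v x)"
    using weak_defect_integrals(3)[OF K uv] by (simp only: g inner_add_right distrib_left)
  also have "\<dots> = weak_defect U F g u + weak_defect U F g v"
    using weak_defect_integrals(1,2)[OF K u] weak_defect_integrals(1,2)[OF K v]
    by (simp add: weak_defect_integrals(3)[OF K u] weak_defect_integrals(3)[OF K v])
  finally show ?thesis .
qed

lemma weak_defect_sum:
  fixes n :: nat
  assumes K: "compact K" "K \<subseteq> U" "continuous_on K F" "continuous_on K g"
    and w: "C_k 1 w" "{x. w x \<noteq> 0} \<subseteq> K"
    and u: "\<And>i. C_k 1 (u i)" "\<And>i. {x. u i x \<noteq> 0} \<subseteq> K"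
  shows "weak_defect U F g (\<lambda>x. w x + (\<Sum>i<n. u i x)) =
    weak_defect U F g w + (\<Sum>i<n. weak_defect U F g (u i))"
proof (induction n)
  case (Suc n)
  have "weak_defect U F g (\<lambda>x. w x + (\<Sum>i<Suc n. u i x)) =
      weak_defect U F g (\<lambda>x. (w x + (\<Sum>i<n. u i x)) + u n x)"
    by (simp add: add.assoc)
  also have "\<dots> = weak_defect U F g (\<lambda>x. w x + (\<Sum>i<n. u i x)) + weak_defect U F g (u n)"
  proof (rule weak_defect_add[OF K _ _ u(1,2)])
    show "C_k 1 (\<lambda>x. w x + (\<Sum>i<n. u i x))"
      by (rule C_k_add[OF w(1) C_k_sum[OF u(1)]])
    show "{x. w x + (\<Sum>i<n. u i x) \<noteq> 0} \<subseteq> K"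
    proof
      fix x assume "x \<in> {x. w x + (\<Sum>i<n. u i x) \<noteq> 0}"
      then have "w x \<noteq> 0 \<or> (\<exists>i. u i x \<noteq> 0)" by (auto intro: ccontr)
      then show "x \<in> K" using w(2) u(2) by blast
    qed
  qed
  finally show ?case using Suc by simp
qed simp

text \<open>
  Since the gradient of a compactly supported function has integral zero, \<open>F\<close> may be replaced
  by its difference from the constant \<open>v\<close>.
\<close>

lemma weak_defect_le:
  fixes F :: "'a::euclidean_space \<Rightarrow> 'a" and \<alpha> :: real
  assumes K: "compact K" "K \<subseteq> U" "continuous_on K F" "continuous_on K g"
    and u: "C_k 1 u" "{x. u x \<noteq> 0} \<subseteq> K"
    and r: "0 < r" "r \<le> 1" and \<alpha>: "\<alpha> \<le> 1"
    and supp: "\<And>x. 3 * r \<le> dist c x \<Longrightarrow> u x = 0"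
    and F: "\<And>x. x \<in> K \<Longrightarrow> dist c x \<le> 3 * r \<Longrightarrow> norm (F x - v) \<le> H * r powr \<alpha>"
    and du: "\<And>x. norm (gradient u x) \<le> B / r"
    and g: "\<And>x. x \<in> K \<Longrightarrow> \<bar>g x\<bar> \<le> G" and uL: "\<And>x. \<bar>u x\<bar> \<le> L"
    and nn: "0 \<le> H" "0 \<le> B" "0 \<le> G"
  shows "\<bar>weak_defect U F g u\<bar> \<le>
    (H * B + G * L) * (unit_ball_vol DIM('a) * 3 ^ DIM('a)) * r powr (real DIM('a) - 1 + \<alpha>)"
proof -
  let ?V = "unit_ball_vol DIM('a) * (3 * r) ^ DIM('a)"
  have L: "0 \<le> L" using uL[of c] by simp
  have u0: "u x = 0" if "x \<notin> K" for x using u(2) that by auto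
  have r3: "0 \<le> 3 * r" using r by simp
  have gz: "gradient u x = 0" if "3 * r < dist c x" for x
    by (rule gradient_zero[of "- cball c (3 * r)"]) (use supp that in \<open>auto simp: open_Compl\<close>)
  note int = weak_defect_integrals[OF K u]
  \<comment> \<open>The integrability statement is applied to the constant field \<open>v\<close> in
    place of \<open>F\<close>.\<close>
  have int_v: "integrable lborel (\<lambda>x. v \<bullet> gradient u x)"
    using weak_defect_integrals(1)[OF K(1,2) continuous_on_const K(4) u] .
  have "(LINT x|lborel. v \<bullet> gradient u x) = 0"
    using integral_gradient_eq_0[OF u(1) K(1) u0, of v] by (simp add: inner_commute)
  then have "(LINT x|lborel. F x \<bullet> gradient u x) = (LINT x|lborel. (F x - v) \<bullet> gradient u x)"
    using int(1) int_v by (simp add: inner_diff_left)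
  also have "\<bar>\<dots>\<bar> \<le> (H * r powr \<alpha> * (B / r)) * ?V"
  proof (rule abs_integral_le_cball[OF _ _ _ r3])
    show "integrable lborel (\<lambda>x. (F x - v) \<bullet> gradient u x)"
      using int(1) int_v by (simp add: inner_diff_left)
    show "(F x - v) \<bullet> gradient u x = 0" if "3 * r < dist c x" for x
      using gz[OF that] by simp
    show "\<bar>(F x - v) \<bullet> gradient u x\<bar> \<le> H * r powr \<alpha> * (B / r)" for x
    proof (cases "x \<in> K \<and> dist c x \<le> 3 * r")
      case True
      have "\<bar>(F x - v) \<bullet> gradient u x\<bar> \<le> norm (F x - v) * norm (gradient u x)"
        by (rule Cauchy_Schwarz_ineq2)
      also have "\<dots> \<le> (H * r powr \<alpha>) * (B / r)"
        using True F du nn by (intro mult_mono) auto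
      finally show ?thesis .
    next
      case False
      then have "gradient u x = 0" using gz int(4) by force
      then show ?thesis using nn r by simp
    qed
  qed
  also have "\<dots> = H * B * (unit_ball_vol DIM('a) * 3 ^ DIM('a)) * r powr (real DIM('a) - 1 + \<alpha>)"
    using r by (simp add: powr_add powr_diff powr_realpow power_mult_distrib)
  finally have 1: "\<bar>LINT x|lborel. F x \<bullet> gradient u x\<bar> \<le> \<dots>" .
  have "\<bar>LINT x|lborel. g x * u x\<bar> \<le> (G * L) * ?V"
  proof (rule abs_integral_le_cball[OF int(2) _ _ r3])
    show "g x * u x = 0" if "3 * r < dist c x" for x
      using supp that by simp
    show "\<bar>g x * u x\<bar> \<le> G * L" for x
      using g[of x] uL[of x] u0[of x] nn L
      by (cases "x \<in> K") (auto simp: abs_mult intro: mult_mono)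
  qed
  also have "\<dots> = G * L * (unit_ball_vol DIM('a) * 3 ^ DIM('a)) * r powr DIM('a)"
    using r by (simp add: powr_realpow power_mult_distrib)
  also have "\<dots> \<le> G * L * (unit_ball_vol DIM('a) * 3 ^ DIM('a)) * r powr (real DIM('a) - 1 + \<alpha>)"
    using r \<alpha> nn L by (intro mult_left_mono powr_mono') auto
  finally have 2: "\<bar>LINT x|lborel. g x * u x\<bar> \<le> \<dots>" .
  show ?thesis
    unfolding int(3) using 1 2 by (simp add: algebra_simps)
qed

section \<open>Cover, partition and defect estimate combined\<close>

theorem proposition4p2:
  fixes A \<gamma> :: "'a::euclidean_space set"
    and \<alpha> :: real
    and F :: "'a \<Rightarrow> 'a"
    and g :: "'a \<Rightarrow> real"
  assumes "open A" and "bounded A"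
    and "0 \<le> \<alpha>" and "\<alpha> \<le> 1"
    and "\<gamma> \<subseteq> A" and "closed \<gamma>"
    and "hausdorff_measure (real DIM('a) - 1 + \<alpha>) \<gamma> = 0"
    and "holder_on \<alpha> A F"
    and "continuous_on UNIV g"
    and "weak_neg_div_eq (A - \<gamma>) F g"
  shows "weak_neg_div_eq A F g"
proof (cases "real DIM('a) - 1 + \<alpha> = 0")
  \<comment> \<open>Here \<open>d = 1\<close> and \<open>\<alpha> = 0\<close>; a null set of the
    counting measure is empty.\<close>
  case True
  then have "\<gamma> = {}" using assms(7) hausdorff_measure_0_eq_0 by metis
  then show ?thesis using assms(10) by simp
next
  case False
  define s where "s = real DIM('a) - 1 + \<alpha>"
  have "1 \<le> real DIM('a)" using DIM_positive[where 'a='a] by linarith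
  with False have s: "s > 0" using assms(3) unfolding s_def by linarith
  have \<gamma>: "compact \<gamma>"
    using assms(2,5,6) bounded_subset compact_eq_bounded_closed by blast
  show ?thesis
    unfolding weak_neg_div_eq_def
  proof
    fix \<phi> assume "\<phi> \<in> test_functions A"
    then have \<phi>: "\<And>k. C_k k \<phi>" "compact (closure {x. \<phi> x \<noteq> 0})" "closure {x. \<phi> x \<noteq> 0} \<subseteq> A"
      by (auto simp: test_functions_def)
    \<comment> \<open>\<open>\<gamma>\<close> is included so that the centres of the cover lie in
      \<open>K\<close> even when they are outside the support of \<open>\<phi>\<close>.\<close>
    define K where "K = closure {x. \<phi> x \<noteq> 0} \<union> \<gamma>"
    have K: "compact K" "K \<subseteq> A" using \<phi>(2,3) \<gamma> assms(5) by (auto simp: K_def)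
    have \<phi>0: "{x. \<phi> x \<noteq> 0} \<subseteq> K"
      using closure_subset[of "{x. \<phi> x \<noteq> 0}"] by (auto simp: K_def)
    have contF: "continuous_on K F"
      using continuous_on_subset[OF holder_on_imp_continuous_on[OF assms(8,3)] K(2)] .
    have contg: "continuous_on K g"
      using continuous_on_subset[OF assms(9) subset_UNIV] .
    note KFg = K contF contg
    obtain H where H: "H \<ge> 0" "\<And>c x r. c \<in> K \<Longrightarrow> x \<in> K \<Longrightarrow> 0 < r \<Longrightarrow> dist c x \<le> 3 * r \<Longrightarrow>
        norm (F x - F c) \<le> H * r powr \<alpha>"
      by (rule holder_on_bound_dist_le[OF assms(8,3) K, of 3]) (simp, rule that)
    have bound: "\<exists>b\<ge>0. \<forall>x\<in>K. norm (h x) \<le> b" if h: "continuous_on K h" for h :: "'a \<Rightarrow> 'c::real_normed_vector"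
    proof -
      obtain b where "\<forall>x\<in>h ` K. norm x \<le> b"
        using compact_imp_bounded[OF compact_continuous_image[OF h K(1)]] unfolding bounded_iff by blast
      then show ?thesis by (intro exI[of _ "max b 0"]) auto
    qed
    have cont\<phi>: "continuous_on K \<phi>" "continuous_on K (gradient \<phi>)"
      using continuous_on_subset[OF C_k_imp_continuous[OF \<phi>(1)] subset_UNIV]
        continuous_on_subset[OF C_k_gradient_continuous[OF \<phi>(1)] subset_UNIV] by blast+
    obtain G where G: "G \<ge> 0" "\<And>x. x \<in> K \<Longrightarrow> \<bar>g x\<bar> \<le> G"
      using bound[OF contg] by auto
    obtain L where L: "L \<ge> 0" "\<And>x. \<bar>\<phi> x\<bar> \<le> L"
    proof -
      obtain L where "L \<ge> 0" "\<And>x. x \<in> K \<Longrightarrow> \<bar>\<phi> x\<bar> \<le> L" using bound[OF cont\<phi>(1)] by auto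
      moreover have "\<phi> x = 0" if "x \<notin> K" for x using \<phi>0 that by auto
      ultimately show thesis using that[of L] by (metis abs_zero)
    qed
    obtain L' where L': "L' \<ge> 0" "\<And>x. norm (gradient \<phi> x) \<le> L'"
    proof -
      obtain L where "L \<ge> 0" "\<And>x. x \<in> K \<Longrightarrow> norm (gradient \<phi> x) \<le> L"
        using bound[OF cont\<phi>(2)] by auto
      moreover have "gradient \<phi> x = 0" if "x \<notin> K" for x
        using weak_defect_integrals(4)[OF KFg \<phi>(1) \<phi>0] that .
      ultimately show thesis using that[of L] by (metis norm_zero)
    qed
    obtain B :: real where B: "B \<ge> 0"
      and part: "\<And>S :: ('a \<times> nat) set. finite S \<Longrightarrow>
      \<exists>n p \<theta>. inj_on p {..<n::nat} \<and> p ` {..<n} \<subseteq> S \<and>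
        (\<forall>i k. C_k k (\<theta> i)) \<and> (\<forall>i x. \<bar>\<theta> i x\<bar> \<le> 1) \<and>
        (\<forall>i x. 3 * (1 / 2) ^ snd (p i) \<le> dist (fst (p i)) x \<longrightarrow> \<theta> i x = 0) \<and>
        (\<forall>i<n. \<forall>x. norm (gradient (\<theta> i) x) \<le> B * 2 ^ snd (p i)) \<and>
        (\<forall>c k x. (c, k) \<in> S \<longrightarrow> dist c x < (1 / 2) ^ k \<longrightarrow> (\<Sum>i<n. \<theta> i x) = 1)"
      by (rule graded_partition_of_unity, rule that)
    \<comment> \<open>The constant of \<open>weak_defect_le\<close> for the pieces, whose gradients
      are bounded by \<open>(L * B + L') / r\<close> according to the product rule.\<close>
    define M where "M = (H * (L * B + L') + G * L) * (unit_ball_vol DIM('a) * 3 ^ DIM('a))"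
    have M: "M \<ge> 0" using H G L L' B by (simp add: M_def)
    have small: "\<bar>weak_defect A F g \<phi>\<bar> \<le> M * e" if e: "e > 0" for e
    proof -
      obtain S :: "('a \<times> nat) set" where S: "finite S" "fst ` S \<subseteq> \<gamma>"
        "\<gamma> \<subseteq> (\<Union>(c, k)\<in>S. ball c ((1 / 2) ^ k))" "(\<Sum>(c, k)\<in>S. ((1 / 2) ^ k) powr s) \<le> e"
        by (rule hausdorff_null_dyadic_cover[OF \<gamma> s assms(7)[folded s_def] e], rule that)
      from part[OF S(1)] obtain n :: nat and p \<theta> where
        p: "inj_on p {..<n}" "p ` {..<n} \<subseteq> S"
        and *: "\<forall>i k. C_k k (\<theta> i)" "\<forall>i x. \<bar>\<theta> i x\<bar> \<le> 1"
          "\<forall>i x. 3 * (1 / 2) ^ snd (p i) \<le> dist (fst (p i)) x \<longrightarrow> \<theta> i x = 0"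
          "\<forall>i<n. \<forall>x. norm (gradient (\<theta> i) x) \<le> B * 2 ^ snd (p i)"
          "\<forall>c k x. (c, k) \<in> S \<longrightarrow> dist c x < (1 / 2) ^ k \<longrightarrow> (\<Sum>i<n. \<theta> i x) = 1"
        by (elim exE conjE) (rule that)
      have \<theta>: "\<And>i k. C_k k (\<theta> i)" "\<And>i x. \<bar>\<theta> i x\<bar> \<le> 1"
        "\<And>i x. 3 * (1 / 2) ^ snd (p i) \<le> dist (fst (p i)) x \<Longrightarrow> \<theta> i x = 0"
        "\<And>i x. i < n \<Longrightarrow> norm (gradient (\<theta> i) x) \<le> B * 2 ^ snd (p i)"
        "\<And>c k x. (c, k) \<in> S \<Longrightarrow> dist c x < (1 / 2) ^ k \<Longrightarrow> (\<Sum>i<n. \<theta> i x) = 1"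
        using * by blast+
      define u where "u i = (\<lambda>x. \<phi> x * \<theta> i x)" for i
      define w where "w = (\<lambda>x. \<phi> x * (1 - (\<Sum>i<n. \<theta> i x)))"
      have u: "C_k k (u i)" for k i unfolding u_def by (intro C_k_mult \<phi> \<theta>)
      have w: "C_k k w" for k
        unfolding w_def by (intro C_k_mult C_k_diff C_k_const C_k_sum \<phi> \<theta>)
      have u0: "{x. u i x \<noteq> 0} \<subseteq> K" for i using \<phi>0 by (auto simp: u_def)
      have w0: "{x. w x \<noteq> 0} \<subseteq> K" using \<phi>0 by (auto simp: w_def)
      have split: "\<phi> = (\<lambda>x. w x + (\<Sum>i<n. u i x))"
        by (simp add: w_def u_def sum_distrib_left[symmetric] right_diff_distrib)
      define K' where "K' = closure {x. w x \<noteq> 0}"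
      have K': "compact K'" "K' \<subseteq> A - \<gamma>"
      proof -
        let ?U = "\<Union>(c, k)\<in>S. ball c ((1 / 2) ^ k)"
        have sub: "K' \<subseteq> closure {x. \<phi> x \<noteq> 0}"
          unfolding K'_def by (intro closure_mono) (auto simp: w_def)
        \<comment> \<open>On the open set \<open>?U\<close>, which contains \<open>\<gamma>\<close>,
          the \<open>\<theta> i\<close> sum to 1 and \<open>w\<close> vanishes; the support of
          \<open>w\<close> therefore keeps away from \<open>\<gamma>\<close>.\<close>
        moreover have "K' \<subseteq> - ?U"
          unfolding K'_def
        proof (rule closure_minimal)
          show "closed (- ?U)" by (intro closed_Compl open_UN) auto
          show "{x. w x \<noteq> 0} \<subseteq> - ?U" using \<theta>(5) by (fastforce simp: w_def)
        qed
        ultimately show "K' \<subseteq> A - \<gamma>" using \<phi>(3) S(3) by blast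
        have "closed K'" by (simp add: K'_def)
        from compact_Int_closed[OF \<phi>(2) this] show "compact K'"
          using sub by (simp add: Int_absorb1)
      qed
      have w'0: "{x. w x \<noteq> 0} \<subseteq> K'"
        unfolding K'_def by (rule closure_subset)
      have "w \<in> test_functions (A - \<gamma>)"
        using w K' by (auto simp: test_functions_def K'_def)
      then have "weak_defect (A - \<gamma>) F g w = 0"
        using assms(10) by (simp add: weak_neg_div_eq_def weak_defect_def)
      moreover have "continuous_on K' F" "continuous_on K' g"
        using continuous_on_subset[OF holder_on_imp_continuous_on[OF assms(8,3)], of K']
          continuous_on_subset[OF assms(9), of K'] K'(2) by auto
      \<comment> \<open>Both sides reduce to the same integrals over the whole space.\<close>
      then have "weak_defect (A - \<gamma>) F g w = weak_defect A F g w"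
        using weak_defect_integrals(3)[OF K' _ _ w w'0] weak_defect_integrals(3)[OF KFg w w0] by simp
      ultimately have w_defect: "weak_defect A F g w = 0" by simp
      have u_defect: "\<bar>weak_defect A F g (u i)\<bar> \<le> M * ((1 / 2) ^ snd (p i)) powr s" if i: "i < n" for i
      proof -
        let ?c = "fst (p i)" and ?r = "(1 / 2 :: real) ^ snd (p i)"
        have r: "0 < ?r" "?r \<le> 1" by (auto intro: power_le_one)
        have r1: "1 \<le> 1 / ?r" using r by simp
        have "?c \<in> \<gamma>" using i p(2) S(2) by blast
        then have c: "?c \<in> K" by (simp add: K_def)
        show ?thesis
          unfolding M_def s_def
        proof (rule weak_defect_le[OF KFg u u0 r assms(4)])
          show "u i x = 0" if "3 * ?r \<le> dist ?c x" for x
            using \<theta>(3)[OF that] by (simp add: u_def)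
          show "norm (F x - F ?c) \<le> H * ?r powr \<alpha>" if "x \<in> K" "dist ?c x \<le> 3 * ?r" for x
            using H(2)[OF c that(1) r(1) that(2)] .
          show "norm (gradient (u i) x) \<le> (L * B + L') / ?r" for x
          proof -
            have "gradient (u i) x = \<phi> x *\<^sub>R gradient (\<theta> i) x + \<theta> i x *\<^sub>R gradient \<phi> x"
              unfolding u_def by (rule gradient_mult[OF \<phi>(1)[of "Suc 0"] \<theta>(1)[of "Suc 0"]])
            also have "norm \<dots> \<le> \<bar>\<phi> x\<bar> * norm (gradient (\<theta> i) x) + \<bar>\<theta> i x\<bar> * norm (gradient \<phi> x)"
              by (rule norm_triangle_le) simp
            also have "\<dots> \<le> L * (B * 2 ^ snd (p i)) + 1 * L'"
              using L L' \<theta>(2,4) i by (intro add_mono mult_mono) auto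
            \<comment> \<open>\<open>2 ^ snd (p i)\<close> is \<open>1 / ?r\<close>, and
              \<open>L' \<le> L' / ?r\<close> because \<open>?r \<le> 1\<close>.\<close>
            also have "\<dots> \<le> L * B * (1 / ?r) + L' * (1 / ?r)"
              using mult_left_mono[OF r1 L'(1)] by (simp add: power_one_over)
            finally show ?thesis by (simp add: add_divide_distrib)
          qed
          show "\<bar>u i x\<bar> \<le> L" for x
            using mult_mono[OF L(2)[of x] \<theta>(2)[of i x]] L(1) by (simp add: u_def abs_mult)
        qed (use H G L L' B in auto)
      qed
      have "weak_defect A F g \<phi> = (\<Sum>i<n. weak_defect A F g (u i))"
        unfolding split weak_defect_sum[OF KFg w w0 u u0] w_defect by simp
      also have "\<bar>\<dots>\<bar> \<le> (\<Sum>i<n. M * ((1 / 2) ^ snd (p i)) powr s)"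
        by (rule order_trans[OF sum_abs sum_mono]) (use u_defect in simp)
      \<comment> \<open>Injectivity of \<open>p\<close> ensures that no ball of the cover is counted
        twice.\<close>
      also have "\<dots> = M * (\<Sum>(c, k)\<in>p ` {..<n}. ((1 / 2) ^ k) powr s)"
        by (simp add: sum.reindex[OF p(1)] sum_distrib_left case_prod_beta)
      also have "\<dots> \<le> M * (\<Sum>(c, k)\<in>S. ((1 / 2) ^ k) powr s)"
        by (intro mult_left_mono sum_mono2 S(1) p(2) M) auto
      also have "\<dots> \<le> M * e" using S(4) M by (rule mult_left_mono)
      finally show ?thesis .
    qed
    have "\<bar>weak_defect A F g \<phi>\<bar> \<le> 0 + e" if "e > 0" for e
    proof -
      \<comment> \<open>Dividing by \<open>M + 1\<close> covers the case
        \<open>M = 0\<close>.\<close>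
      have "\<bar>weak_defect A F g \<phi>\<bar> \<le> M * (e / (M + 1))" using that M by (intro small) simp
      also have "\<dots> \<le> e" using that M by (simp add: field_simps)
      finally show ?thesis by simp
    qed
    then have "\<bar>weak_defect A F g \<phi>\<bar> \<le> 0" by (rule field_le_epsilon)
    then show "(LINT x:A|lborel. F x \<bullet> gradient \<phi> x) = (LINT x:A|lborel. g x * \<phi> x)"
      by (simp add: weak_defect_def)
  qed
qed

end
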